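(* Let $\mathscr{S}_n$ be the set of all strictly metric path systems on $n$ vertices. Then, as $n\to\infty$, $$2^{0.51 n^2(1-o(1))}\le |\mathscr{S}_n|\le 2^{1.38 n^2(1-o(1))}.$$
   Context: A consistent path system $\mathcal{P}$ in a finite simple undirected graph $G=(V,E)$ is a collection of simple paths in $G$ such that: (1) for every pair of distinct vertices $u,v\in V$ there is exactly one path in $\mathcal{P}$ with end vertices $u,v$, denoted $P_{u,v}=P_{v,u}$ (paths are undirected); (2) the non-empty intersection of any two paths in $\mathcal{P}$ is either a single vertex or a path in $\mathcal{P}$. A path system on $n$ vertices means one in the complete graph $K_n$ on the vertex set $[n]=\{1,\dots,n\}$. A path system $\mathcal{P}$ in $G=(V,E)$ is strictly metric if there is a weight function $w:E\to\mathbb{R}_{>0}$ such that each path in $\mathcal{P}$ is the unique $w$-shortest path between its end vertices (the weight of a path being the sum of the weights of its edges). Strictly metric path systems are automatically consistent. *)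

theory Defs
  imports Complex_Main "HOL-Library.Landau_Symbols"
begin

text \<open>
  A finite simple undirected graph is given by a vertex set \<open>V\<close> and a set \<open>E\<close> of edges, each edge
  being a two-element set of vertices.  A path with at least one edge is a subgraph that is
  determined by its set of edges, so an (undirected) path is represented by its edge set \<open>p\<close>;
  its vertex set is then \<open>\<Union>p\<close>.
\<close>

definition complete_edges :: "'a set \<Rightarrow> 'a set set" where
  "complete_edges V = {{u, v} | u v. u \<in> V \<and> v \<in> V \<and> u \<noteq> v}"

definition walk_edges :: "'a list \<Rightarrow> 'a set set" where
  "walk_edges xs = {{xs ! i, xs ! Suc i} | i. Suc i < length xs}"

definition simple_path :: "'a set set \<Rightarrow> 'a \<Rightarrow> 'a \<Rightarrow> 'a set set \<Rightarrow> bool" where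
  "simple_path E u v p \<longleftrightarrow>
     (\<exists>xs. xs \<noteq> [] \<and> distinct xs \<and> hd xs = u \<and> last xs = v \<and> walk_edges xs = p \<and> p \<subseteq> E)"

text \<open>
  Only pairs of distinct vertices carry a path, so a path system contains no one-vertex paths.
\<close>

definition path_system :: "'a set \<Rightarrow> 'a set set \<Rightarrow> 'a set set set \<Rightarrow> bool" where
  "path_system V E P \<longleftrightarrow>
     (\<forall>p\<in>P. \<exists>u\<in>V. \<exists>v\<in>V. u \<noteq> v \<and> simple_path E u v p) \<and>
     (\<forall>u\<in>V. \<forall>v\<in>V. u \<noteq> v \<longrightarrow> (\<exists>!p. p \<in> P \<and> simple_path E u v p))"

text \<open>
  Paths are intersected as subgraphs: vertex sets and edge sets are intersected separately, and
  the result is a path in \<open>P\<close> if it has the vertices and the edges of some \<open>r \<in> P\<close>.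
\<close>

definition consistent_path_system :: "'a set \<Rightarrow> 'a set set \<Rightarrow> 'a set set set \<Rightarrow> bool" where
  "consistent_path_system V E P \<longleftrightarrow>
     path_system V E P \<and>
     (\<forall>p\<in>P. \<forall>q\<in>P. \<Union>p \<inter> \<Union>q \<noteq> {} \<longrightarrow>
        (\<exists>x. \<Union>p \<inter> \<Union>q = {x}) \<or>
        (\<exists>r\<in>P. \<Union>p \<inter> \<Union>q = \<Union>r \<and> p \<inter> q = r))"

definition unique_shortest_path ::
    "'a set set \<Rightarrow> ('a set \<Rightarrow> real) \<Rightarrow> 'a \<Rightarrow> 'a \<Rightarrow> 'a set set \<Rightarrow> bool" where
  "unique_shortest_path E w u v p \<longleftrightarrow>
     simple_path E u v p \<and>
     (\<forall>q. simple_path E u v q \<and> q \<noteq> p \<longrightarrow> (\<Sum>e\<in>p. w e) < (\<Sum>e\<in>q. w e))"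

definition strictly_metric :: "'a set set \<Rightarrow> 'a set set set \<Rightarrow> bool" where
  "strictly_metric E P \<longleftrightarrow>
     (\<exists>w :: 'a set \<Rightarrow> real. (\<forall>e\<in>E. w e > 0) \<and>
        (\<forall>p\<in>P. \<forall>u v. simple_path E u v p \<longrightarrow> unique_shortest_path E w u v p))"

definition strictly_metric_systems :: "nat \<Rightarrow> nat set set set set" where
  "strictly_metric_systems n =
     {P. consistent_path_system {1..n} (complete_edges {1..n}) P \<and>
         strictly_metric (complete_edges {1..n}) P}"

lemma finite_complete_edges: "finite V \<Longrightarrow> finite (complete_edges V)"
  by (rule finite_subset[of _ "Pow V"]) (auto simp: complete_edges_def)

lemma simple_path_subset: "simple_path E u v p \<Longrightarrow> p \<subseteq> E"
  by (auto simp: simple_path_def)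

text \<open>So \<open>card (strictly_metric_systems n)\<close> is a genuine count.\<close>

lemma finite_strictly_metric_systems: "finite (strictly_metric_systems n)"
proof (rule finite_subset)
  show "strictly_metric_systems n \<subseteq> Pow (Pow (complete_edges {1..n}))"
  proof (intro subsetI PowI)
    fix P p e
    assume "P \<in> strictly_metric_systems n" and "p \<in> P" and e: "e \<in> p"
    then have "\<exists>u v. simple_path (complete_edges {1..n}) u v p"
      unfolding strictly_metric_systems_def consistent_path_system_def path_system_def by fast
    with e show "e \<in> complete_edges {1..n}"
      using simple_path_subset by fast
  qed
  show "finite (Pow (Pow (complete_edges {1..n})))"
    by (simp add: finite_complete_edges)
qed

end

theory Submission
  imports Defs "HOL-Library.FuncSet" "HOL-Library.Nat_Bijection"
begin

text \<open>
  Both bounds compare a path system with data attached to the \<open>N \<approx> n\<^sup>2 / 2\<close> edges of the complete graph.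

  For the upper bound, let \<open>D\<close> be the distance of a strictly metric system.  Give the edge \<open>{u, v}\<close> the
  weight \<open>D u v - \<epsilon>\<close>, and for each edge choose the cheapest among the edge itself and its detours
  through a third vertex.  For small \<open>\<epsilon>\<close> the choice is the edge exactly if the edge is the geodesic, and
  a detour goes through a vertex of the geodesic (\<open>shortest_detours_follow_geodesics\<close>); by recursion
  the choices determine the whole system (\<open>follows_determines_geodesics\<close>).  Now record only the
  vector that counts, for each edge, how many of the choices use this edge.  Any other selection
  with the same vector has the same total weight, and is therefore optimal as well; so this
  vector still determines the system (\<open>card_le_via_minimisers\<close>).  It has \<open>N\<close> natural entries of sum
  at most \<open>2 * N\<close>, and there are at most \<open>(27 / 4) ^ N\<close> such vectors (\<open>card_bounded_sum\<close>).  Finally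
  \<open>27 / 4 \<le> 2 powr 2.76\<close>.

  For the lower bound, join a hub to all vertices by edges of moderate weight, so that every pair has a
  path of two edges.  Then an arbitrary set of the other edges may be made so long that they are no
  geodesics, and this set can be read off the system.  This gives one bit per edge, that is
  \<open>0.5 * n\<^sup>2\<close>.  To gain more, place \<open>m\<^sup>2\<close> edge-disjoint triangles on \<open>4 * m\<close> vertices.  In
  a triangle whose base is absent and whose legs are present, one more bit is available: the
  geodesic for the base may or may not run over the apex.  For this the apex must be the best
  middle vertex irrespective of what happens in other triangles.  It is, if the vertices lie on a
  line, the apex at the midpoint of the base, and the weights of the legs grow with the squared
  distance of their ends.  So each triangle has 9 states
  in place of 8, and \<open>9 \<ge> 2 powr 3.16\<close> suffices to lift the constant to \<open>0.51\<close>
  (\<open>direct_iff_not_absent\<close>, \<open>light_iff_path_via_midpoint\<close>, \<open>config_read_off\<close>).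

  The two constructions meet in the locale \<open>geodesics\<close> of weights with unique shortest paths, in which
  also the consistency of the resulting path systems is proved.
\<close>

section \<open>Walks and simple paths\<close>

lemma walk_edges_simps [simp]:
  "walk_edges [] = {}"
  "walk_edges [x] = {}"
  "walk_edges (x # y # zs) = insert {x, y} (walk_edges (y # zs))"
proof -
  show "walk_edges (x # y # zs) = insert {x, y} (walk_edges (y # zs))"
  proof (intro equalityI subsetI)
    fix e assume "e \<in> walk_edges (x # y # zs)"
    then obtain i where i: "e = {(x # y # zs) ! i, (x # y # zs) ! Suc i}" "Suc i < length (x # y # zs)"
      unfolding walk_edges_def by blast
    then show "e \<in> insert {x, y} (walk_edges (y # zs))"
      by (cases i) (auto simp: walk_edges_def)
  next
    fix e assume "e \<in> insert {x, y} (walk_edges (y # zs))"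
    then consider "e = {x, y}" | i where "e = {(y # zs) ! i, (y # zs) ! Suc i}" "Suc i < length (y # zs)"
      unfolding walk_edges_def by blast
    then show "e \<in> walk_edges (x # y # zs)"
    proof cases
      case 1
      then show ?thesis unfolding walk_edges_def by (auto intro!: exI[of _ 0])
    next
      case (2 i)
      then show ?thesis unfolding walk_edges_def by (auto intro!: exI[of _ "Suc i"])
    qed
  qed
qed (simp_all add: walk_edges_def)

lemma walk_edges_append:
  "walk_edges (xs @ x # ys) = walk_edges (xs @ [x]) \<union> walk_edges (x # ys)"
proof (induction xs)
  case (Cons a xs)
  then show ?case by (cases xs) auto
qed simp

lemma walk_edges_rev [simp]: "walk_edges (rev xs) = walk_edges xs"
proof (induction xs rule: induct_list012)
  case (3 x y zs)
  have "walk_edges (rev zs @ [y, x]) = walk_edges (rev zs @ [y]) \<union> walk_edges [y, x]"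
    by (rule walk_edges_append)
  then show ?case using 3 by (auto simp: insert_commute)
qed simp_all

lemma finite_walk_edges [simp]: "finite (walk_edges xs)"
  by (induction xs rule: induct_list012) auto

lemma Union_walk_edges_subset: "\<Union>(walk_edges xs) \<subseteq> set xs"
  by (induction xs rule: induct_list012) auto

lemma Union_walk_edges: "2 \<le> length xs \<Longrightarrow> \<Union>(walk_edges xs) = set xs"
proof (induction xs rule: induct_list012)
  case (3 x y zs)
  then show ?case by (cases zs) auto
qed auto

lemma first_edge_notin: "distinct (x # xs) \<Longrightarrow> x \<in> e \<Longrightarrow> e \<notin> walk_edges xs"
  using Union_walk_edges_subset[of xs] by auto

lemma card_walk_edges: "distinct xs \<Longrightarrow> card (walk_edges xs) = length xs - 1"
proof (induction xs rule: induct_list012)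
  case (3 x y zs)
  then have "{x, y} \<notin> walk_edges (y # zs)" by (intro first_edge_notin[of x]) auto
  then show ?case using 3 by simp
qed simp_all

lemma walk_edge_meets:
  "e \<in> walk_edges (xs @ [x]) \<Longrightarrow> e \<inter> set xs \<noteq> {}"
  "e \<in> walk_edges (x # xs) \<Longrightarrow> e \<inter> set xs \<noteq> {}"
proof -
  show "e \<in> walk_edges (x # xs) \<Longrightarrow> e \<inter> set xs \<noteq> {}"
    by (induction xs arbitrary: x) auto
  show "e \<in> walk_edges (xs @ [x]) \<Longrightarrow> e \<inter> set xs \<noteq> {}"
  proof (induction xs)
    case (Cons a xs)
    then show ?case by (cases xs) auto
  qed simp
qed

lemma walk_edges_disjoint:
  assumes "distinct (xs @ x # ys)"
  shows "walk_edges (xs @ [x]) \<inter> walk_edges (x # ys) = {}"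
proof -
  have "e \<notin> walk_edges (x # ys)" if "e \<in> walk_edges (xs @ [x])" for e
    using walk_edge_meets(1)[OF that] Union_walk_edges_subset[of "x # ys"] assms by auto
  then show ?thesis by blast
qed

text \<open>Cutting out the loops of a walk leaves a simple path with no new edges.\<close>

lemma walk_contains_path:
  "xs \<noteq> [] \<Longrightarrow> \<exists>ys. ys \<noteq> [] \<and> distinct ys \<and> hd ys = hd xs \<and> last ys = last xs
     \<and> walk_edges ys \<subseteq> walk_edges xs"
proof (induction xs rule: list_nonempty_induct)
  case (single x)
  then show ?case by (intro exI[of _ "[x]"]) simp
next
  case (cons x xs)
  then obtain ys where ys: "ys \<noteq> []" "distinct ys" "hd ys = hd xs" "last ys = last xs"
    "walk_edges ys \<subseteq> walk_edges xs" by blast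
  show ?case
  proof (cases "x \<in> set ys")
    case True
    then obtain as bs where "ys = as @ x # bs" by (meson split_list)
    then show ?thesis using ys cons.hyps walk_edges_append[of as x bs]
      by (intro exI[of _ "x # bs"]) (cases xs; auto)
  next
    case False
    then show ?thesis using ys cons.hyps
      by (intro exI[of _ "x # ys"]) (cases xs; cases ys; auto)
  qed
qed

lemma simple_path_sym: "simple_path E u v p \<Longrightarrow> simple_path E v u p"
  unfolding simple_path_def by (metis distinct_rev hd_rev last_rev rev_is_Nil_conv walk_edges_rev)

lemma simple_path_finite: "simple_path E u v p \<Longrightarrow> finite p"
  unfolding simple_path_def by auto

lemma simple_path_trans:
  assumes "simple_path E u x p" "simple_path E x v q"
  shows "\<exists>r. simple_path E u v r \<and> r \<subseteq> p \<union> q"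
proof -
  obtain xs ys where xs: "xs \<noteq> []" "hd xs = u" "last xs = x" "walk_edges xs = p" "p \<subseteq> E"
    and ys: "ys \<noteq> []" "hd ys = x" "last ys = v" "walk_edges ys = q" "q \<subseteq> E"
    using assms unfolding simple_path_def by blast
  obtain zs where zs: "ys = x # zs" using ys by (cases ys) auto
  have xs': "xs = butlast xs @ [x]" using xs by (metis append_butlast_last_id)
  let ?l = "butlast xs @ x # zs"
  have "walk_edges ?l = p \<union> q"
    using walk_edges_append[of "butlast xs" x zs] xs' xs(4) ys(4) zs by metis
  moreover have "hd ?l = u" using xs' xs(2) by (cases "butlast xs") auto
  moreover have "last ?l = v" using ys(3) zs by simp
  ultimately obtain l where "l \<noteq> []" "distinct l" "hd l = u" "last l = v" "walk_edges l \<subseteq> p \<union> q"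
    using walk_contains_path[of ?l] by auto
  then show ?thesis using xs(5) ys(5) unfolding simple_path_def by blast
qed

lemma simple_path_refl_iff: "simple_path E u u p \<longleftrightarrow> p = {}"
proof
  assume "simple_path E u u p"
  then obtain xs where xs: "xs \<noteq> []" "distinct xs" "hd xs = last xs" "walk_edges xs = p"
    unfolding simple_path_def by metis
  then show "p = {}" by (cases xs) (auto split: if_splits)
next
  assume "p = {}"
  then show "simple_path E u u p" unfolding simple_path_def by (intro exI[of _ "[u]"]) auto
qed

lemma complete_edgesI: "u \<in> V \<Longrightarrow> v \<in> V \<Longrightarrow> u \<noteq> v \<Longrightarrow> {u, v} \<in> complete_edges V"
  unfolding complete_edges_def by blast

lemma Union_complete_edges: "p \<subseteq> complete_edges V \<Longrightarrow> \<Union>p \<subseteq> V"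
  unfolding complete_edges_def by blast

lemma card_complete_edges:
  assumes "finite V"
  shows "card (complete_edges V) = card V choose 2"
proof -
  have "complete_edges V = {e. e \<subseteq> V \<and> card e = 2}"
  proof (intro equalityI subsetI)
    fix e assume "e \<in> {e. e \<subseteq> V \<and> card e = 2}"
    then obtain u v where "e = {u, v}" "u \<noteq> v" "u \<in> V" "v \<in> V" by (auto simp: card_2_iff)
    then show "e \<in> complete_edges V" using complete_edgesI by metis
  qed (auto simp: complete_edges_def)
  then show ?thesis using n_subsets[OF assms] by simp
qed

lemma simple_path_edge: "{u, v} \<in> E \<Longrightarrow> u \<noteq> v \<Longrightarrow> simple_path E u v {{u, v}}"
  unfolding simple_path_def by (intro exI[of _ "[u, v]"]) auto

lemma simple_path_two:
  "{u, x} \<in> E \<Longrightarrow> {x, v} \<in> E \<Longrightarrow> distinct [u, x, v] \<Longrightarrow> simple_path E u v {{u, x}, {x, v}}"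
  unfolding simple_path_def by (intro exI[of _ "[u, x, v]"]) auto

lemma simple_path_Union:
  assumes "simple_path E u v p" "u \<noteq> v"
  shows "u \<in> \<Union>p" "v \<in> \<Union>p"
proof -
  obtain xs where xs: "xs \<noteq> []" "hd xs = u" "last xs = v" "walk_edges xs = p"
    using assms(1) unfolding simple_path_def by blast
  with assms(2) have "2 \<le> length xs" by (cases xs; cases "tl xs") auto
  then have "\<Union>p = set xs" using Union_walk_edges xs(4) by metis
  then show "u \<in> \<Union>p" "v \<in> \<Union>p" using xs(1-3) hd_in_set last_in_set by metis+
qed

lemma simple_path_cases:
  assumes "simple_path (complete_edges V) u v p" "u \<noteq> v"
  obtains (edge) "p = {{u, v}}"
    | (two) y where "y \<in> V" "y \<noteq> u" "y \<noteq> v" "p = {{u, y}, {y, v}}"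
    | (long) "3 \<le> card p"
proof -
  obtain xs where xs: "xs \<noteq> []" "distinct xs" "hd xs = u" "last xs = v" "walk_edges xs = p"
    and p: "p \<subseteq> complete_edges V"
    using assms(1) unfolding simple_path_def by blast
  obtain y ys where ys: "xs = u # y # ys"
    using xs(1,3,4) assms(2) by (cases xs; cases "tl xs") auto
  consider "ys = []" | "ys = [v]" | "4 \<le> length xs"
    using xs(4) ys by (cases ys; cases "tl ys") auto
  then show thesis
  proof cases
    case 1
    then show ?thesis using xs ys edge by auto
  next
    case 2
    then have y: "p = {{u, y}, {y, v}}" "y \<noteq> u" "y \<noteq> v" using xs ys by auto
    moreover have "y \<in> V" using Union_complete_edges[OF p] unfolding y(1) by simp
    ultimately show ?thesis by (intro two)
  next
    case 3
    then show ?thesis using card_walk_edges[OF xs(2)] xs(5) long by simp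
  qed
qed

text \<open>The ends of a path are its vertices of odd degree, so the edge set determines them.\<close>

lemma odd_degree_walk:
  "xs \<noteq> [] \<Longrightarrow> distinct xs \<Longrightarrow>
     odd (card {e \<in> walk_edges xs. a \<in> e}) \<longleftrightarrow> (a = hd xs) \<noteq> (a = last xs)"
proof (induction xs rule: induct_list012)
  case (3 x y zs)
  let ?S = "{e \<in> walk_edges (y # zs). a \<in> e}"
  have new: "{x, y} \<notin> walk_edges (y # zs)" using 3 by (intro first_edge_notin[of x]) auto
  have "{e \<in> walk_edges (x # y # zs). a \<in> e} = (if a \<in> {x, y} then insert {x, y} ?S else ?S)"
    by auto
  then have deg: "card {e \<in> walk_edges (x # y # zs). a \<in> e} = (if a \<in> {x, y} then Suc (card ?S) else card ?S)"
    using new by simp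
  have IH: "odd (card ?S) \<longleftrightarrow> (a = y) \<noteq> (a = last (y # zs))" using 3 by simp
  have parity: "odd n \<longleftrightarrow> (a = x) \<noteq> (a = l)"
    if "n = (if a \<in> {x, y} then Suc c else c)" "odd c \<longleftrightarrow> (a = y) \<noteq> (a = l)" "l \<noteq> x" "x \<noteq> y" for n c l
    using that by auto
  have ne: "last (y # zs) \<noteq> x" "x \<noteq> y" using 3(4) last_in_set[of "y # zs"] by auto
  have "hd (x # y # zs) = x" "last (x # y # zs) = last (y # zs)" by simp_all
  with parity[OF deg IH ne] show ?case by (simp only:)
qed simp_all

lemma odd_degree_path:
  assumes "simple_path E u v p"
  shows "odd (card {e \<in> p. a \<in> e}) \<longleftrightarrow> (a = u) \<noteq> (a = v)"
proof -
  obtain xs where "xs \<noteq> []" "distinct xs" "hd xs = u" "last xs = v" "walk_edges xs = p"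
    using assms unfolding simple_path_def by blast
  with odd_degree_walk[of xs a] show ?thesis by simp
qed

lemma simple_path_ends:
  assumes "simple_path E u v p" "simple_path E' u' v' p" "u \<noteq> v"
  shows "{u, v} = {u', v'}"
proof -
  have "(a = u) \<noteq> (a = v) \<longleftrightarrow> (a = u') \<noteq> (a = v')" for a
    using odd_degree_path[OF assms(1), of a] odd_degree_path[OF assms(2), of a] by simp
  from this[of u] this[of v] show ?thesis using assms(3) by (auto simp: doubleton_eq_iff)
qed

section \<open>Unique geodesics\<close>

locale geodesics =
  fixes V :: "'a set" and w :: "'a set \<Rightarrow> real" and P :: "'a \<Rightarrow> 'a \<Rightarrow> 'a set set"
  assumes finite_V: "finite V"
    and w_pos: "e \<in> complete_edges V \<Longrightarrow> 0 < w e"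
    and geo: "u \<in> V \<Longrightarrow> v \<in> V \<Longrightarrow> unique_shortest_path (complete_edges V) w u v (P u v)"
begin

abbreviation E where "E \<equiv> complete_edges V"

definition D where "D u v = sum w (P u v)"

definition system where "system = {P u v | u v. u \<in> V \<and> v \<in> V \<and> u \<noteq> v}"

lemma P_path: "u \<in> V \<Longrightarrow> v \<in> V \<Longrightarrow> simple_path E u v (P u v)"
  using geo unfolding unique_shortest_path_def by blast

lemma P_edges: "u \<in> V \<Longrightarrow> v \<in> V \<Longrightarrow> P u v \<subseteq> E" "u \<in> V \<Longrightarrow> v \<in> V \<Longrightarrow> finite (P u v)"
  using P_path simple_path_subset simple_path_finite by metis+

lemma D_le: "u \<in> V \<Longrightarrow> v \<in> V \<Longrightarrow> simple_path E u v q \<Longrightarrow> D u v \<le> sum w q"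
  using geo unfolding unique_shortest_path_def D_def by (metis less_imp_le order_refl)

lemma shortest_eq: "u \<in> V \<Longrightarrow> v \<in> V \<Longrightarrow> simple_path E u v q \<Longrightarrow> sum w q \<le> D u v \<Longrightarrow> q = P u v"
  using geo unfolding unique_shortest_path_def D_def by (metis not_le)

lemma P_sym: "u \<in> V \<Longrightarrow> v \<in> V \<Longrightarrow> P u v = P v u"
  using shortest_eq[of v u "P u v"] D_le[of u v "P v u"] P_path simple_path_sym
  unfolding D_def by metis

lemma D_sym: "u \<in> V \<Longrightarrow> v \<in> V \<Longrightarrow> D u v = D v u"
  unfolding D_def using P_sym by metis

lemma P_refl: "u \<in> V \<Longrightarrow> P u u = {}"
  using P_path simple_path_refl_iff by metis

lemma w_nonneg: "e \<in> E \<Longrightarrow> 0 \<le> w e"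
  using w_pos by force

lemma sum_w_union:
  assumes "p \<subseteq> E" "q \<subseteq> E" "finite p" "finite q"
  shows "sum w (p \<union> q) \<le> sum w p + sum w q"
proof -
  have "0 \<le> sum w (p \<inter> q)" using assms w_nonneg by (intro sum_nonneg) auto
  then show ?thesis using sum.union_inter[of p q w] assms by linarith
qed

text \<open>
  Equality in the triangle inequality forces the geodesic from \<open>u\<close> to \<open>v\<close> through \<open>x\<close>:  the
  concatenation contains a simple path, which is then no shorter than the concatenation itself.
\<close>

lemma triangle:
  assumes "u \<in> V" "x \<in> V" "v \<in> V"
  shows "D u v \<le> D u x + D x v"
    and "D u v = D u x + D x v \<Longrightarrow> P u v = P u x \<union> P x v"
proof -
  let ?U = "P u x \<union> P x v"
  obtain r where r: "simple_path E u v r" "r \<subseteq> ?U"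
    using simple_path_trans P_path assms by meson
  have U: "?U \<subseteq> E" "finite ?U" using P_edges assms by auto
  have a: "D u v \<le> sum w r" by (rule D_le[OF assms(1,3) r(1)])
  have b: "sum w r \<le> sum w ?U" using r U w_nonneg by (intro sum_mono2) auto
  have c: "sum w ?U \<le> D u x + D x v"
    unfolding D_def using P_edges assms by (intro sum_w_union) auto
  show "D u v \<le> D u x + D x v" using a b c by linarith
  assume eq: "D u v = D u x + D x v"
  then have "r = P u v" using shortest_eq[OF assms(1,3) r(1)] b c by linarith
  moreover have "r = ?U"
  proof (rule ccontr)
    assume "r \<noteq> ?U"
    then obtain e where "e \<in> ?U - r" using r by blast
    then have "sum w r < sum w ?U"
      using r U w_nonneg w_pos by (intro sum_strict_mono2[of _ _ e]) auto
    with a c eq show False by linarith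
  qed
  ultimately show "P u v = ?U" by simp
qed

text \<open>
  Cutting a geodesic at one of its vertices gives two simple paths, whose weights are at least the
  two distances.  The triangle inequality leaves no slack, so both pieces are geodesics.
\<close>

lemma split_geodesic:
  assumes "u \<in> V" "v \<in> V" "distinct (as @ x # bs)" "hd (as @ x # bs) = u" "last (as @ x # bs) = v"
    and P: "walk_edges (as @ x # bs) = P u v"
  shows "x \<in> V" "walk_edges (as @ [x]) = P u x" "walk_edges (x # bs) = P x v"
    "D u v = D u x + D x v"
proof -
  have "x \<in> \<Union>(P u v) \<or> x = u"
    using assms(4) Union_walk_edges[of "as @ x # bs"] P by (cases as; cases bs) auto
  then show x: "x \<in> V" using Union_complete_edges P_edges assms(1,2) by blast
  have E: "walk_edges (as @ [x]) \<subseteq> E" "walk_edges (x # bs) \<subseteq> E"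
    using P P_edges(1)[OF assms(1,2)] unfolding walk_edges_append[of as x bs] by auto
  have path1: "simple_path E u x (walk_edges (as @ [x]))"
    unfolding simple_path_def using assms(3,4) E(1)
    by (intro exI[of _ "as @ [x]"]) (cases as; auto)
  have path2: "simple_path E x v (walk_edges (x # bs))"
    unfolding simple_path_def using assms(3,5) E(2) by (intro exI[of _ "x # bs"]) auto
  have sum: "D u v = sum w (walk_edges (as @ [x])) + sum w (walk_edges (x # bs))"
    unfolding D_def P[symmetric] walk_edges_append[of as x bs]
    using walk_edges_disjoint[OF assms(3)] by (intro sum.union_disjoint) auto
  note le = D_le[OF assms(1) x path1] D_le[OF x assms(2) path2] triangle(1)[OF assms(1) x assms(2)]
  show "walk_edges (as @ [x]) = P u x" using shortest_eq[OF assms(1) x path1] le sum by linarith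
  show "walk_edges (x # bs) = P x v" using shortest_eq[OF x assms(2) path2] le sum by linarith
  show "D u v = D u x + D x v" using le sum by linarith
qed

lemma P_list:
  assumes "u \<in> V" "v \<in> V" "u \<noteq> v"
  obtains xs where "distinct xs" "hd xs = u" "last xs = v" "walk_edges xs = P u v"
    "\<Union>(P u v) = set xs" "2 \<le> length xs"
proof -
  obtain xs where xs: "xs \<noteq> []" "distinct xs" "hd xs = u" "last xs = v" "walk_edges xs = P u v"
    using P_path[OF assms(1,2)] unfolding simple_path_def by blast
  moreover have "2 \<le> length xs" using xs assms(3) by (cases xs; cases "tl xs") auto
  ultimately show thesis using that Union_walk_edges[of xs] by metis
qed

lemma D_on_geodesic:
  assumes "u \<in> V" "v \<in> V" "x \<in> \<Union>(P u v)"
  shows "x \<in> V" "D u v = D u x + D x v" "P u v = P u x \<union> P x v"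
proof -
  have "u \<noteq> v" using assms P_refl by auto
  then obtain xs where xs: "distinct xs" "hd xs = u" "last xs = v" "walk_edges xs = P u v"
    "\<Union>(P u v) = set xs" by (metis P_list assms(1,2))
  then obtain as bs where "xs = as @ x # bs" using assms(3) by (metis split_list)
  then show "x \<in> V" "D u v = D u x + D x v" using split_geodesic[OF assms(1,2)] xs by auto
  then show "P u v = P u x \<union> P x v" using triangle(2) assms by blast
qed

lemma on_geodesic_iff:
  assumes "u \<in> V" "v \<in> V" "x \<in> V" "x \<noteq> u"
  shows "x \<in> \<Union>(P u v) \<longleftrightarrow> D u v = D u x + D x v"
  using triangle(2)[of u x v] simple_path_Union(2)[OF P_path[of u x]] D_on_geodesic(2) assms
  by (metis Union_Un_distrib UnI1)

lemma D_pos: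
  assumes "u \<in> V" "v \<in> V" "u \<noteq> v"
  shows "0 < D u v"
  unfolding D_def
proof (rule sum_pos)
  show "finite (P u v)" using P_edges(2) assms by blast
  show "P u v \<noteq> {}" using simple_path_Union(1)[OF P_path] assms by blast
  show "0 < w e" if "e \<in> P u v" for e using that P_edges(1) w_pos assms by blast
qed

text \<open>
  The vertex \<open>a\<close> splits the geodesic into two, one of which contains \<open>b\<close>; splitting that one at
  \<open>b\<close> exhibits \<open>P a b\<close> as one of the pieces.
\<close>

lemma subpath_subset:
  assumes "u \<in> V" "v \<in> V" "a \<in> \<Union>(P u v)" "b \<in> \<Union>(P u v)"
  shows "P a b \<subseteq> P u v"
proof -
  note a = D_on_geodesic[OF assms(1-3)]
  consider "b \<in> \<Union>(P u a)" | "b \<in> \<Union>(P a v)" using assms(4) a(3) by auto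
  then show ?thesis
  proof cases
    case 1
    then show ?thesis using D_on_geodesic[OF assms(1) a(1) 1] a(1,3) P_sym by blast
  next
    case 2
    then show ?thesis using D_on_geodesic[OF a(1) assms(2) 2] a(3) by blast
  qed
qed

text \<open>
  This is the consistency axiom.  If \<open>a\<close> and \<open>b\<close> are the first and the last vertex of one geodesic
  that lie on the other, then \<open>P a b\<close> is a piece of both, and nothing outside this piece is common.
\<close>

lemma geodesics_meet:
  assumes uv: "u \<in> V" "v \<in> V" "u \<noteq> v" and st: "s \<in> V" "t \<in> V"
    and meet: "\<Union>(P u v) \<inter> \<Union>(P s t) \<noteq> {}"
  shows "(\<exists>x. \<Union>(P u v) \<inter> \<Union>(P s t) = {x}) \<or>
    (\<exists>r\<in>system. \<Union>(P u v) \<inter> \<Union>(P s t) = \<Union>r \<and> P u v \<inter> P s t = r)"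
proof -
  define Q where "Q = \<Union>(P s t)"
  obtain xs where xs: "distinct xs" "hd xs = u" "last xs = v" "walk_edges xs = P u v"
    "\<Union>(P u v) = set xs" by (metis P_list uv)
  then have "\<exists>x\<in>set xs. x \<in> Q" using meet unfolding Q_def by blast
  \<comment> \<open>The first common vertex is \<open>a\<close>, the last one is \<open>b\<close>.\<close>
  then obtain as a cs where a: "xs = as @ a # cs" "a \<in> Q" "\<forall>x\<in>set as. x \<notin> Q"
    using split_list_first_prop[of xs "\<lambda>x. x \<in> Q"] by blast
  then have "\<exists>x\<in>set (a # cs). x \<in> Q" by simp
  then obtain ds b bs where b: "a # cs = ds @ b # bs" "b \<in> Q" "\<forall>x\<in>set bs. x \<notin> Q"
    using split_list_last_prop[of "a # cs" "\<lambda>x. x \<in> Q"] by blast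
  have set_xs: "set xs = set as \<union> set ds \<union> {b} \<union> set bs" using a(1) b(1) by auto
  then have common: "set xs \<inter> Q \<subseteq> set ds \<union> {b}" using a(3) b(3) by blast
  show ?thesis
  proof (cases ds)
    case Nil
    then have "set xs \<inter> Q = {b}" using common set_xs b(2) by auto
    then show ?thesis unfolding xs(5) Q_def by blast
  next
    case (Cons a' ds')
    then have ds: "ds = a # ds'" "cs = ds' @ b # bs" using b(1) by simp_all
    note A = split_geodesic[OF uv(1,2) xs(1-4)[unfolded a(1)]]
    have av: "walk_edges (ds @ b # bs) = P a v" using A(3) b(1) by simp
    have "distinct (ds @ b # bs)" "hd (ds @ b # bs) = a" "last (ds @ b # bs) = v"
      using xs(1,3) unfolding a(1) b(1) using ds(1) by simp_all
    note B = split_geodesic[OF A(1) uv(2) this av]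
    have "a \<noteq> b" using xs(1) a(1) ds(2) by auto
    then have r: "P a b \<in> system" unfolding system_def using A(1) B(1) by blast
    have verts: "\<Union>(P a b) = set ds \<union> {b}"
      using Union_walk_edges[of "ds @ [b]"] B(2) ds(1) by (simp add: insert_commute)
    have Pq: "P a b \<subseteq> P s t" using subpath_subset[OF st] a(2) b(2) unfolding Q_def by blast
    have "a \<in> set xs" "b \<in> set xs" using a(1) set_xs by auto
    then have Pp: "P a b \<subseteq> P u v" using subpath_subset[OF uv(1,2)] xs(5) by simp
    have "P u v = walk_edges (as @ [a]) \<union> walk_edges (ds @ b # bs)"
      using walk_edges_append[of as a cs] xs(4) a(1) b(1) by simp
    then have dec: "P u v = walk_edges (as @ [a]) \<union> P a b \<union> walk_edges (b # bs)"
      using walk_edges_append[of ds b bs] B(2) by blast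
    have "e \<in> P a b" if e: "e \<in> P u v" "e \<in> P s t" for e
    proof -
      have "e \<subseteq> Q" using e(2) unfolding Q_def by blast
      then have "e \<notin> walk_edges (as @ [a])" "e \<notin> walk_edges (b # bs)"
        using walk_edge_meets(1)[of e as a] walk_edge_meets(2)[of e b bs] a(3) b(3) by blast+
      then show ?thesis using e(1) dec by blast
    qed
    then have edges: "P u v \<inter> P s t = P a b" using Pp Pq by blast
    have "\<Union>(P u v) \<inter> \<Union>(P s t) = \<Union>(P a b)"
    proof
      show "\<Union>(P a b) \<subseteq> \<Union>(P u v) \<inter> \<Union>(P s t)" using Pp Pq by blast
      show "\<Union>(P u v) \<inter> \<Union>(P s t) \<subseteq> \<Union>(P a b)" using common unfolding verts xs(5) Q_def .
    qed
    with edges r show ?thesis by blast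
  qed
qed

lemma systemE:
  assumes "p \<in> system" "simple_path E u v p"
  shows "u \<in> V" "v \<in> V" "u \<noteq> v" "p = P u v"
proof -
  obtain a b where ab: "a \<in> V" "b \<in> V" "a \<noteq> b" "p = P a b" using assms(1) unfolding system_def by blast
  have "{a, b} = {u, v}" using simple_path_ends[OF P_path[OF ab(1,2)]] ab assms(2) by metis
  then show "u \<in> V" "v \<in> V" "u \<noteq> v" "p = P u v" using ab P_sym by (auto simp: doubleton_eq_iff)
qed

lemma system_path_system: "path_system V E system"
  unfolding path_system_def
proof (intro conjI ballI impI)
  fix p assume "p \<in> system"
  then show "\<exists>u\<in>V. \<exists>v\<in>V. u \<noteq> v \<and> simple_path E u v p"
    unfolding system_def using P_path by blast
next
  fix u v assume uv: "u \<in> V" "v \<in> V" "u \<noteq> v"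
  show "\<exists>!p. p \<in> system \<and> simple_path E u v p"
  proof (rule ex1I)
    show "P u v \<in> system \<and> simple_path E u v (P u v)"
      using uv P_path unfolding system_def by blast
    show "p = P u v" if "p \<in> system \<and> simple_path E u v p" for p
      using systemE(4) that by blast
  qed
qed

lemma system_consistent: "consistent_path_system V E system"
  unfolding consistent_path_system_def
proof (intro conjI ballI impI)
  show "path_system V E system" by (rule system_path_system)
next
  fix p q assume "p \<in> system" "q \<in> system" "\<Union>p \<inter> \<Union>q \<noteq> {}"
  then obtain u v s t where "u \<in> V" "v \<in> V" "u \<noteq> v" "p = P u v" "s \<in> V" "t \<in> V" "q = P s t"
    "\<Union>(P u v) \<inter> \<Union>(P s t) \<noteq> {}"
    unfolding system_def by blast
  then show "(\<exists>x. \<Union>p \<inter> \<Union>q = {x}) \<or> (\<exists>r\<in>system. \<Union>p \<inter> \<Union>q = \<Union>r \<and> p \<inter> q = r)"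
    using geodesics_meet by simp
qed

lemma system_strictly_metric: "strictly_metric E system"
  unfolding strictly_metric_def
proof (intro exI[of _ w] conjI ballI allI impI)
  show "0 < w e" if "e \<in> E" for e using w_pos that .
  show "unique_shortest_path E w u v p" if "p \<in> system" "simple_path E u v p" for p u v
    using systemE[OF that] geo by simp
qed

end

text \<open>
  On the diagonal, where a path system has no path, the empty edge set is the unique shortest path.
\<close>

lemma geodesics_of_system:
  assumes "finite V" "path_system V (complete_edges V) S" "strictly_metric (complete_edges V) S"
  obtains w P where "geodesics V w P" "S = geodesics.system V P"
proof -
  let ?E = "complete_edges V"
  obtain w where w: "\<forall>e\<in>?E. w e > 0"
    "\<forall>p\<in>S. \<forall>u v. simple_path ?E u v p \<longrightarrow> unique_shortest_path ?E w u v p"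
    using assms(3) unfolding strictly_metric_def by blast
  define P where "P u v = (if u = v then {} else THE p. p \<in> S \<and> simple_path ?E u v p)" for u v
  have P: "P u v \<in> S \<and> simple_path ?E u v (P u v)" if "u \<in> V" "v \<in> V" "u \<noteq> v" for u v
  proof -
    have "\<exists>!p. p \<in> S \<and> simple_path ?E u v p" using assms(2) that unfolding path_system_def by blast
    from theI'[OF this] show ?thesis using that(3) unfolding P_def by simp
  qed
  have geo: "geodesics V w P"
  proof
    show "unique_shortest_path ?E w u v (P u v)" if "u \<in> V" "v \<in> V" for u v
    proof (cases "u = v")
      case True
      then show ?thesis by (auto simp: unique_shortest_path_def simple_path_refl_iff P_def)
    next
      case False
      then show ?thesis using P that w(2) by blast
    qed
  qed (use assms(1) w in auto)
  moreover have "S = geodesics.system V P"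
  proof (intro equalityI subsetI)
    fix p assume "p \<in> S"
    then obtain u v where uv: "u \<in> V" "v \<in> V" "u \<noteq> v" "simple_path ?E u v p"
      using assms(2) unfolding path_system_def by blast
    then have "p = P u v" using P[OF uv(1-3)] assms(2) \<open>p \<in> S\<close> unfolding path_system_def by blast
    then show "p \<in> geodesics.system V P" using uv unfolding geodesics.system_def[OF geo] by blast
  next
    fix p assume "p \<in> geodesics.system V P"
    then show "p \<in> S" using P unfolding geodesics.system_def[OF geo] by blast
  qed
  ultimately show thesis using that by blast
qed

section \<open>Counting by congestion vectors\<close>

text \<open>
  Weigh a vector \<open>m\<close> by \<open>t ^ sum m E\<close> with \<open>t = 2 / 3\<close>.  Each vector counted here has weight at least
  \<open>t ^ (2 * N)\<close>, and the total weight of all vectors factors into geometric sums, each at most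
  \<open>1 / (1 - t) = 3\<close>.  The choice \<open>t = 2 / 3\<close> maximises \<open>t\<^sup>2 * (1 - t)\<close>, whose inverse \<open>27 / 4\<close> is the
  number of choices per coordinate; the exact count is a binomial coefficient of the same growth.
\<close>

lemma card_bounded_sum:
  assumes "finite E"
  shows "real (card {m \<in> PiE E (\<lambda>_. {..2 * card E}). sum m E \<le> 2 * card E}) \<le> (27 / 4) ^ card E"
    (is "real (card ?M) \<le> _")
proof -
  let ?N = "card E" and ?A = "PiE E (\<lambda>_. {..2 * card E})" and ?t = "2 / 3 :: real"
  have fin: "finite ?A" using assms by (intro finite_PiE) auto
  have "(\<Sum>k\<le>n. ?t ^ k) = 3 - 2 * ?t ^ n" for n
    by (induction n) auto
  then have geometric: "(\<Sum>k\<le>n. ?t ^ k) \<le> 3" for n by simp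
  have "real (card ?M) * ?t ^ (2 * ?N) = (\<Sum>m\<in>?M. ?t ^ (2 * ?N))" by simp
  also have "\<dots> \<le> (\<Sum>m\<in>?M. ?t ^ sum m E)" by (intro sum_mono power_decreasing) auto
  also have "\<dots> \<le> (\<Sum>m\<in>?A. ?t ^ sum m E)" using fin by (intro sum_mono2) auto
  also have "\<dots> = (\<Sum>m\<in>?A. \<Prod>e\<in>E. ?t ^ m e)" by (simp only: power_sum)
  also have "\<dots> = (\<Prod>e\<in>E. \<Sum>k\<le>2 * ?N. ?t ^ k)"
    using assms by (intro prod_sum_PiE[symmetric]) auto
  also have "\<dots> \<le> (\<Prod>e\<in>E. 3)" using geometric by (intro prod_mono) (auto intro: sum_nonneg)
  also have "\<dots> = 3 ^ ?N" by simp
  finally have "real (card ?M) \<le> 3 ^ ?N / ?t ^ (2 * ?N)" by (simp add: field_simps)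
  also have "\<dots> = (27 / 4) ^ ?N" by (simp add: power_mult power_divide[symmetric] power2_eq_square)
  finally show ?thesis .
qed

lemma sum_if_mem:
  assumes "finite E" "A \<subseteq> E"
  shows "(\<Sum>e\<in>E. if e \<in> A then f e else 0) = sum f A"
  using sum.inter_restrict[OF assms(1), of f A] assms(2) by (simp add: Int_absorb1)

text \<open>
  The congestion of \<open>e\<close> is the number of chosen sets that contain \<open>e\<close>.  The total weight of a choice
  depends on its congestions only, so two choices with equal congestions have equal total weight; if
  one of them is nowhere dearer than the other, then it is nowhere cheaper either.
\<close>

lemma minimiser_determined_by_congestion:
  fixes W :: "'e \<Rightarrow> real"
  assumes fin: "finite I" "finite E"
    and s: "\<And>i. i \<in> I \<Longrightarrow> s i \<subseteq> E" "\<And>i. i \<in> I \<Longrightarrow> s' i \<subseteq> E"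
    and le: "\<And>i. i \<in> I \<Longrightarrow> sum W (s i) \<le> sum W (s' i)"
    and congestion: "\<And>e. e \<in> E \<Longrightarrow> card {i \<in> I. e \<in> s i} = card {i \<in> I. e \<in> s' i}"
    and i: "i \<in> I"
  shows "sum W (s' i) = sum W (s i)"
proof -
  have total: "(\<Sum>i\<in>I. sum W (t i)) = (\<Sum>e\<in>E. real (card {i \<in> I. e \<in> t i}) * W e)"
    if "\<And>i. i \<in> I \<Longrightarrow> t i \<subseteq> E" for t
  proof -
    have "(\<Sum>i\<in>I. sum W (t i)) = (\<Sum>i\<in>I. \<Sum>e\<in>E. if e \<in> t i then W e else 0)"
      by (rule sum.cong[OF refl]) (use that fin(2) in \<open>simp add: sum_if_mem\<close>)
    also have "\<dots> = (\<Sum>e\<in>E. \<Sum>i\<in>I. if e \<in> t i then W e else 0)" by (rule sum.swap)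
    also have "\<dots> = (\<Sum>e\<in>E. real (card {i \<in> I. e \<in> t i}) * W e)"
      by (rule sum.cong[OF refl]) (use fin(1) in \<open>simp add: sum.inter_filter[symmetric]\<close>)
    finally show ?thesis .
  qed
  have "(\<Sum>i\<in>I. sum W (s i)) = (\<Sum>i\<in>I. sum W (s' i))"
    using total[OF s(1)] total[OF s(2)] congestion by simp
  from sum_mono_inv[OF this le i fin(1)] show ?thesis by simp
qed

text \<open>
  An object that can be reconstructed from every optimal choice for some weight is encoded by the
  congestion vector of one optimal choice: a choice with the same vector is optimal as well.  The
  entries of the vector add up to at most \<open>2 * card E\<close>, because a candidate has at most two elements.
\<close>

lemma card_le_via_minimisers:
  fixes E :: "'e set" and S :: "'s set" and R :: "'s \<Rightarrow> ('e \<Rightarrow> 'e set) \<Rightarrow> bool"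
  assumes E: "finite E"
    and F: "\<And>e. e \<in> E \<Longrightarrow> finite (F e)" "\<And>e. e \<in> E \<Longrightarrow> F e \<noteq> {}"
      "\<And>e t. e \<in> E \<Longrightarrow> t \<in> F e \<Longrightarrow> t \<subseteq> E" "\<And>e t. e \<in> E \<Longrightarrow> t \<in> F e \<Longrightarrow> card t \<le> 2"
    and cost: "\<And>x. x \<in> S \<Longrightarrow> \<exists>W :: 'e \<Rightarrow> real. \<forall>s.
      (\<forall>e\<in>E. s e \<in> F e \<and> (\<forall>t\<in>F e. sum W (s e) \<le> sum W t)) \<longrightarrow> R x s"
    and R_inj: "\<And>x y s. x \<in> S \<Longrightarrow> y \<in> S \<Longrightarrow> R x s \<Longrightarrow> R y s \<Longrightarrow> x = y"
  shows "real (card S) \<le> (27 / 4) ^ card E"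
proof -
  obtain W :: "'s \<Rightarrow> 'e \<Rightarrow> real" where W: "\<And>x s. x \<in> S \<Longrightarrow>
      (\<forall>e\<in>E. s e \<in> F e \<and> (\<forall>t\<in>F e. sum (W x) (s e) \<le> sum (W x) t)) \<Longrightarrow> R x s"
    using bchoice[of S "\<lambda>x W. \<forall>s. (\<forall>e\<in>E. s e \<in> F e \<and> (\<forall>t\<in>F e. sum W (s e) \<le> sum W t)) \<longrightarrow> R x s"] cost
    by blast
  define s where "s x e = arg_min_on (sum (W x)) (F e)" for x e
  have s: "s x e \<in> F e" "t \<in> F e \<Longrightarrow> sum (W x) (s x e) \<le> sum (W x) t" if "e \<in> E" for x e t
    unfolding s_def using arg_min_if_finite[OF F(1,2)[OF that]] arg_min_least[OF F(1,2)[OF that]]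
    by auto
  define m where "m x = restrict (\<lambda>e. card {i \<in> E. e \<in> s x i}) E" for x
  let ?M = "{m \<in> PiE E (\<lambda>_. {..2 * card E}). sum m E \<le> 2 * card E}"
  have "inj_on m S"
  proof (rule inj_onI)
    fix x y assume xy: "x \<in> S" "y \<in> S" "m x = m y"
    have "card {i \<in> E. e \<in> s x i} = card {i \<in> E. e \<in> s y i}" if "e \<in> E" for e
      using fun_cong[OF xy(3), of e] that unfolding m_def by simp
    then have "sum (W x) (s y i) = sum (W x) (s x i)" if "i \<in> E" for i
      using s F(3) that E by (intro minimiser_determined_by_congestion[of E E "s x" "s y"]) blast+
    then have "R x (s y)" using s by (intro W[OF xy(1)]) simp
    moreover have "R y (s y)" using s by (intro W[OF xy(2)]) simp
    ultimately show "x = y" using R_inj xy by blast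
  qed
  moreover have "m x \<in> ?M" for x
  proof -
    have "sum (m x) E = (\<Sum>e\<in>E. \<Sum>i\<in>E. if e \<in> s x i then 1 else 0)"
      unfolding m_def by (rule sum.cong[OF refl]) (use E in \<open>simp add: sum.inter_filter[symmetric]\<close>)
    also have "\<dots> = (\<Sum>i\<in>E. \<Sum>e\<in>E. if e \<in> s x i then 1 else 0)" by (rule sum.swap)
    also have "\<dots> = (\<Sum>i\<in>E. card (s x i))"
    proof (rule sum.cong[OF refl])
      fix i assume "i \<in> E"
      then have "s x i \<subseteq> E" using s F(3) by blast
      then show "(\<Sum>e\<in>E. if e \<in> s x i then 1 else 0) = card (s x i)"
        using E by (simp add: sum_if_mem)
    qed
    also have "\<dots> \<le> (\<Sum>i\<in>E. 2)" using s F(4) by (intro sum_mono) blast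
    finally have le: "sum (m x) E \<le> 2 * card E" by simp
    moreover have "m x e \<le> sum (m x) E" if "e \<in> E" for e
      using that E by (intro member_le_sum) auto
    ultimately show ?thesis unfolding m_def by (auto intro: order_trans)
  qed
  moreover have "finite ?M" using E by (simp add: finite_PiE)
  ultimately have "card S \<le> card ?M" by (intro card_inj_on_le[of m]) auto
  then show ?thesis using card_bounded_sum[OF E] by linarith
qed

section \<open>Detours\<close>

text \<open>
  Replacing the edge \<open>e = {u, v}\<close> by the path from \<open>u\<close> through \<open>x\<close> to \<open>v\<close>, written so that the two
  ends of \<open>e\<close> need no order.
\<close>

definition detour :: "'a \<Rightarrow> 'a set \<Rightarrow> 'a set set" where
  "detour x e = (\<lambda>u. {u, x}) ` e"

definition detours :: "'a set \<Rightarrow> 'a set \<Rightarrow> 'a set set set" where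
  "detours V e = insert {e} ((\<lambda>x. detour x e) ` (V - e))"

lemma detour_doubleton: "detour x {u, v} = {{u, x}, {x, v}}"
  unfolding detour_def by (auto simp: insert_commute)

lemma detour_inj: "e \<noteq> {} \<Longrightarrow> x \<notin> e \<Longrightarrow> y \<notin> e \<Longrightarrow> detour x e = detour y e \<Longrightarrow> x = y"
proof -
  assume e: "e \<noteq> {}" "x \<notin> e" "y \<notin> e" and eq: "detour x e = detour y e"
  have U: "\<Union>(detour z e) = insert z e" for z using e(1) unfolding detour_def by auto
  have "insert x e = insert y e" using U[of x] U[of y] eq by simp
  then show "x = y" using e by blast
qed

lemma direct_neq_detour: "x \<notin> e \<Longrightarrow> {e} \<noteq> detour x e"
  unfolding detour_def by blast

lemma detours_facts:
  assumes "finite V" "e \<in> complete_edges V" "t \<in> detours V e"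
  shows "t \<subseteq> complete_edges V" "card t \<le> 2"
proof -
  obtain u v where e: "e = {u, v}" "u \<in> V" "v \<in> V" "u \<noteq> v"
    using assms(2) unfolding complete_edges_def by blast
  consider "t = {e}" | x where "x \<in> V" "x \<noteq> u" "x \<noteq> v" "t = {{u, x}, {x, v}}"
    using assms(3) unfolding detours_def e(1) by (auto simp: detour_doubleton)
  then have "t \<subseteq> complete_edges V \<and> card t \<le> 2"
  proof cases
    case 1
    then show ?thesis using assms(2) by simp
  next
    case (2 x)
    then have "{u, x} \<in> complete_edges V" "{x, v} \<in> complete_edges V"
      using e complete_edgesI by metis+
    then show ?thesis unfolding 2(4) by (simp add: card_insert_if)
  qed
  then show "t \<subseteq> complete_edges V" "card t \<le> 2" by blast+
qed

context geodesics
begin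

definition follows :: "('a set \<Rightarrow> 'a set set) \<Rightarrow> bool" where
  "follows s \<longleftrightarrow> (\<forall>u\<in>V. \<forall>v\<in>V. u \<noteq> v \<longrightarrow>
     s {u, v} = {{u, v}} \<and> P u v = {{u, v}} \<or>
     (\<exists>x\<in>V - {u, v}. s {u, v} = detour x {u, v} \<and> x \<in> \<Union>(P u v)))"

text \<open>
  There are finitely many triples, so a defect in the triangle inequality that is not zero exceeds
  some fixed \<open>\<epsilon>\<close>.
\<close>

lemma gap:
  obtains \<epsilon> where "\<epsilon> > 0"
    "\<And>u v x. u \<in> V \<Longrightarrow> v \<in> V \<Longrightarrow> x \<in> V \<Longrightarrow> D u x + D x v - D u v \<le> \<epsilon> \<Longrightarrow> D u v = D u x + D x v"
proof -
  define A where "A = insert 1 {r \<in> (\<lambda>(u, v, x). D u x + D x v - D u v) ` (V \<times> V \<times> V). 0 < r}"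
  have fin: "finite A" "A \<noteq> {}" unfolding A_def using finite_V by auto
  have "0 < Min A" using fin unfolding A_def by (subst Min_gr_iff) auto
  moreover have "D u v = D u x + D x v"
    if V: "u \<in> V" "v \<in> V" "x \<in> V" and le: "D u x + D x v - D u v \<le> Min A / 2" for u v x
  proof (rule ccontr)
    assume "D u v \<noteq> D u x + D x v"
    then have "0 < D u x + D x v - D u v" using triangle(1)[of u x v] V by linarith
    then have "D u x + D x v - D u v \<in> A" unfolding A_def using V by force
    then have "Min A \<le> D u x + D x v - D u v" using fin by simp
    then show False using le \<open>0 < Min A\<close> by linarith
  qed
  ultimately show thesis using that[of "Min A / 2"] by simp
qed

text \<open>
  The weight is \<open>W {u, v} = D u v - \<epsilon>\<close>.  A detour pays the discount \<open>\<epsilon>\<close> twice: this makes a detour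
  along the geodesic strictly cheaper than the direct edge, whereas a detour that leaves the geodesic
  is longer by more than \<open>\<epsilon>\<close> and so strictly dearer.  Nothing is claimed about which vertex of the
  geodesic is used, so ties do no harm.
\<close>

lemma shortest_detours_follow_geodesics:
  "\<exists>W :: 'a set \<Rightarrow> real. \<forall>s. (\<forall>e\<in>E. s e \<in> detours V e \<and> (\<forall>t\<in>detours V e. sum W (s e) \<le> sum W t)) \<longrightarrow> follows s"
proof -
  obtain \<epsilon> where eps: "\<epsilon> > 0"
    "\<And>u v x. u \<in> V \<Longrightarrow> v \<in> V \<Longrightarrow> x \<in> V \<Longrightarrow> D u x + D x v - D u v \<le> \<epsilon> \<Longrightarrow> D u v = D u x + D x v"
    by (rule gap) blast
  \<comment> \<open>As \<open>D\<close> is symmetric and vanishes on the diagonal, this is \<open>D u v - \<epsilon>\<close> for \<open>e = {u, v}\<close>.\<close>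
  define W where "W e = (\<Sum>u\<in>e. \<Sum>v\<in>e. D u v) / 2 - \<epsilon>" for e
  have D_refl: "D u u = 0" if "u \<in> V" for u unfolding D_def using P_refl that by simp
  have W: "W {u, v} = D u v - \<epsilon>" if "u \<in> V" "v \<in> V" "u \<noteq> v" for u v
    unfolding W_def using that D_refl D_sym[of u v] by simp
  have W_detour: "sum W (detour x {u, v}) = D u x + D x v - 2 * \<epsilon>"
    if "u \<in> V" "v \<in> V" "x \<in> V" "u \<noteq> v" "x \<noteq> u" "x \<noteq> v" for u v x
  proof -
    have "{u, x} \<noteq> {x, v}" using that by (auto simp: doubleton_eq_iff)
    then show ?thesis unfolding detour_doubleton using that W[of u x] W[of x v] by simp
  qed
  have "follows s"
    if s: "\<forall>e\<in>E. s e \<in> detours V e \<and> (\<forall>t\<in>detours V e. sum W (s e) \<le> sum W t)" for s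
    unfolding follows_def
  proof (intro ballI impI)
    fix u v assume uv: "u \<in> V" "v \<in> V" "u \<noteq> v"
    then have e: "{u, v} \<in> E" by (rule complete_edgesI)
    have min: "sum W (s {u, v}) \<le> sum W t" if "t \<in> detours V {u, v}" for t
      using s e that by blast
    have "s {u, v} \<in> detours V {u, v}" using s e by blast
    then consider "s {u, v} = {{u, v}}" | x where "x \<in> V - {u, v}" "s {u, v} = detour x {u, v}"
      unfolding detours_def by blast
    then show "s {u, v} = {{u, v}} \<and> P u v = {{u, v}} \<or>
      (\<exists>x\<in>V - {u, v}. s {u, v} = detour x {u, v} \<and> x \<in> \<Union>(P u v))"
    proof cases
      case 1
      have empty: "x \<notin> \<Union>(P u v)" if x: "x \<in> V" "x \<noteq> u" "x \<noteq> v" for x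
      proof -
        have "sum W {{u, v}} \<le> sum W (detour x {u, v})"
          using min[of "detour x {u, v}"] x unfolding 1 detours_def by simp
        then have "D u v \<noteq> D u x + D x v" using W W_detour x uv eps(1) by simp
        then show ?thesis using on_geodesic_iff[of u v x] uv x by blast
      qed
      obtain xs where xs: "distinct xs" "hd xs = u" "last xs = v" "walk_edges xs = P u v"
        "\<Union>(P u v) = set xs" "2 \<le> length xs" by (metis P_list uv)
      then obtain y ys where ys: "xs = u # y # ys" by (cases xs; cases "tl xs") auto
      have "y \<in> \<Union>(P u v)" "y \<noteq> u" using xs(1,5) ys by auto
      then have "y = v" using empty D_on_geodesic(1)[OF uv(1,2)] by blast
      then have "last (y # ys) = y" "distinct (y # ys)" using xs(1,3) ys by simp_all
      then have "ys = []" using last_in_set[of ys] by (cases "ys = []") simp_all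
      then have "P u v = {{u, v}}" using xs(4) ys \<open>y = v\<close> by simp
      with 1 show ?thesis by blast
    next
      case (2 x)
      have "sum W (detour x {u, v}) \<le> sum W {{u, v}}"
        using min[of "{{u, v}}"] unfolding 2(2) detours_def by simp
      then have "D u x + D x v - D u v \<le> \<epsilon>" using W[OF uv] W_detour[of u v x] uv 2(1) by simp
      then have "x \<in> \<Union>(P u v)" using eps(2) on_geodesic_iff[of u v x] uv 2(1) by blast
      with 2 show ?thesis by blast
    qed
  qed
  then show ?thesis by blast
qed

end

text \<open>
  The choice at \<open>{u, v}\<close> is either the edge, which then is the geodesic, or it names a vertex that
  splits the geodesic into two with fewer edges.
\<close>

lemma follows_determines_geodesics:
  assumes "geodesics V w P" "geodesics V w' P'"
    and "geodesics.follows V P s" "geodesics.follows V P' s"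
    and "u \<in> V" "v \<in> V"
  shows "P u v = P' u v"
  using assms(5,6)
proof (induction "card (P u v)" arbitrary: u v rule: less_induct)
  case less
  interpret A: geodesics V w P by fact
  interpret B: geodesics V w' P' by fact
  note uv = less.prems
  show ?case
  proof (cases "u = v")
    case True
    then show ?thesis using A.P_refl B.P_refl uv by simp
  next
    case False
    have a: "s {u, v} = {{u, v}} \<and> P u v = {{u, v}} \<or>
        (\<exists>x\<in>V - {u, v}. s {u, v} = detour x {u, v} \<and> x \<in> \<Union>(P u v))"
      using assms(3) uv False unfolding A.follows_def by blast
    have b: "s {u, v} = {{u, v}} \<and> P' u v = {{u, v}} \<or>
        (\<exists>x\<in>V - {u, v}. s {u, v} = detour x {u, v} \<and> x \<in> \<Union>(P' u v))"
      using assms(4) uv False unfolding B.follows_def by blast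
    show ?thesis
    proof (cases "s {u, v} = {{u, v}}")
      case True
      then have "P u v = {{u, v}}" "P' u v = {{u, v}}"
        using a b direct_neq_detour[of _ "{u, v}"] by (metis DiffD2)+
      then show ?thesis by simp
    next
      case F: False
      then obtain x where x: "x \<in> V" "x \<notin> {u, v}" "s {u, v} = detour x {u, v}" "x \<in> \<Union>(P u v)"
        using a by blast
      have xB: "x \<in> \<Union>(P' u v)" using b F detour_inj[OF _ x(2), of _] x(3) by blast
      note PA = A.D_on_geodesic[OF uv x(4)] and PB = B.D_on_geodesic[OF uv xB]
      have "0 < A.D u x" "0 < A.D x v" using A.D_pos uv x(1,2) by auto
      then have "A.D u x \<noteq> A.D u v" "A.D x v \<noteq> A.D u v" using PA(2) by linarith+
      then have "P u x \<noteq> P u v" "P x v \<noteq> P u v" unfolding A.D_def by metis+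
      then have "P u x \<subset> P u v" "P x v \<subset> P u v" using PA(3) by blast+
      then have "card (P u x) < card (P u v)" "card (P x v) < card (P u v)"
        using A.P_edges(2)[OF uv] by (auto intro: psubset_card_mono)
      then show ?thesis using less.hyps uv x(1) PA(3) PB(3) by metis
    qed
  qed
qed

lemma card_strictly_metric_le:
  "real (card (strictly_metric_systems n)) \<le> (27 / 4) ^ card (complete_edges {1..n})"
proof -
  let ?V = "{1..n}"
  let ?R = "\<lambda>S s. \<exists>w P. geodesics ?V w P \<and> S = geodesics.system ?V P \<and> geodesics.follows ?V P s"
  show ?thesis
  proof (rule card_le_via_minimisers[where F = "detours ?V" and R = ?R])
    show "finite (complete_edges ?V)" by (simp add: finite_complete_edges)
    fix e assume e: "e \<in> complete_edges ?V"
    show "finite (detours ?V e)" "detours ?V e \<noteq> {}" unfolding detours_def by auto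
    fix t assume "t \<in> detours ?V e"
    moreover have "finite ?V" by simp
    ultimately show "t \<subseteq> complete_edges ?V" "card t \<le> 2"
      using detours_facts[OF _ e] by blast+
  next
    fix S assume S: "S \<in> strictly_metric_systems n"
    then obtain w P where P: "geodesics ?V w P" "S = geodesics.system ?V P"
      unfolding strictly_metric_systems_def consistent_path_system_def
      using geodesics_of_system[of ?V S] by (metis (no_types, lifting) finite_atLeastAtMost mem_Collect_eq)
    obtain W :: "nat set \<Rightarrow> real" where W: "\<And>s. \<forall>e\<in>complete_edges ?V. s e \<in> detours ?V e \<and>
        (\<forall>t\<in>detours ?V e. sum W (s e) \<le> sum W t) \<Longrightarrow> geodesics.follows ?V P s"
      using geodesics.shortest_detours_follow_geodesics[OF P(1)] by blast
    have "?R S s" if "\<forall>e\<in>complete_edges ?V. s e \<in> detours ?V e \<and>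
        (\<forall>t\<in>detours ?V e. sum W (s e) \<le> sum W t)" for s
      using P W[OF that] by blast
    then show "\<exists>W :: nat set \<Rightarrow> real. \<forall>s. (\<forall>e\<in>complete_edges ?V. s e \<in> detours ?V e \<and>
        (\<forall>t\<in>detours ?V e. sum W (s e) \<le> sum W t)) \<longrightarrow> ?R S s"
      by (intro exI[of _ W]) blast
  next
    fix S T s assume "?R S s" "?R T s"
    then obtain w P w' P' where
      S: "geodesics ?V w P" "S = geodesics.system ?V P" "geodesics.follows ?V P s" and
      T: "geodesics ?V w' P'" "T = geodesics.system ?V P'" "geodesics.follows ?V P' s" by blast
    have "P u v = P' u v" if "u \<in> ?V" "v \<in> ?V" for u v
      using follows_determines_geodesics[OF S(1) T(1) S(3) T(3) that] .
    then show "S = T"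
      unfolding S(2) T(2) geodesics.system_def[OF S(1)] geodesics.system_def[OF T(1)] by metis
  qed
qed

section \<open>Geodesics for integer weights\<close>

text \<open>
  The perturbation of the \<open>i\<close>-th element is \<open>2 ^ i / 2 ^ N\<close>.  The fractional part of the weight of a set
  thus lists the set in binary, and it is too small to disturb comparisons between integers.
\<close>

lemma generic_perturbation:
  fixes b :: "'e \<Rightarrow> int"
  assumes "finite E" "\<And>e. e \<in> E \<Longrightarrow> 0 < b e"
  shows "\<exists>w :: 'e \<Rightarrow> real. (\<forall>e\<in>E. 0 < w e) \<and> inj_on (sum w) (Pow E) \<and>
    (\<forall>A\<subseteq>E. of_int (sum b A) \<le> sum w A \<and> sum w A < of_int (sum b A) + 1)"
proof -
  obtain f where f: "bij_betw f E {0..<card E}" using ex_bij_betw_finite_nat[OF assms(1)] by blast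
  let ?N = "2 ^ card E :: real"
  define w where "w e = of_int (b e) + 2 ^ f e / ?N" for e
  have sum_w: "sum w A = of_int (sum b A) + real (set_encode (f ` A)) / ?N" if "A \<subseteq> E" for A
  proof -
    have "inj_on f A" using f that by (meson bij_betw_def inj_on_subset)
    then show ?thesis
      unfolding w_def set_encode_def
      by (simp add: sum.distrib sum_divide_distrib sum.reindex)
  qed
  have code: "real (set_encode (f ` A)) < ?N" if "A \<subseteq> E" for A
  proof -
    have "f ` A \<subseteq> {0..<card E}" using f that unfolding bij_betw_def by blast
    then have "set_encode (f ` A) \<le> (\<Sum>i=0..<card E. 2 ^ i)"
      unfolding set_encode_def by (intro sum_mono2) auto
    also have "\<dots> < 2 ^ card E" by (simp add: sum_power2)
    finally show ?thesis by (metis of_nat_less_iff of_nat_numeral of_nat_power)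
  qed
  have frac: "0 \<le> real (set_encode (f ` A)) / ?N" "real (set_encode (f ` A)) / ?N < 1" if "A \<subseteq> E" for A
    using code[OF that] by simp_all
  have "A = B" if A: "A \<subseteq> E" and B: "B \<subseteq> E" and eq: "sum w A = sum w B" for A B
  proof -
    have "\<lfloor>sum w A\<rfloor> = sum b A" "\<lfloor>sum w B\<rfloor> = sum b B"
      using sum_w frac A B by (auto intro!: floor_unique)
    then have "sum b A = sum b B" using eq by simp
    then have "real (set_encode (f ` A)) / ?N = real (set_encode (f ` B)) / ?N"
      using sum_w[OF A] sum_w[OF B] eq by linarith
    then have "set_encode (f ` A) = set_encode (f ` B)" by simp
    moreover have "finite (f ` A)" "finite (f ` B)" using assms(1) A B finite_subset by blast+
    ultimately have "f ` A = f ` B" using set_encode_eq[of "f ` A" "f ` B"] by simp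
    moreover have "inj_on f E" using f unfolding bij_betw_def by blast
    ultimately show ?thesis using A B by (simp add: inj_on_image_eq_iff)
  qed
  then have "inj_on (sum w) (Pow E)" by (intro inj_onI) auto
  moreover have "0 < w e" if "e \<in> E" for e unfolding w_def using assms(2)[OF that] by (simp add: add_pos_pos)
  moreover have "of_int (sum b A) \<le> sum w A \<and> sum w A < of_int (sum b A) + 1" if "A \<subseteq> E" for A
    using sum_w[OF that] frac[OF that] by linarith
  ultimately show ?thesis by (intro exI[of _ w]) blast
qed

lemma integer_weight_geodesics:
  fixes b :: "'a set \<Rightarrow> int"
  assumes "finite V" "\<And>e. e \<in> complete_edges V \<Longrightarrow> 0 < b e"
  shows "\<exists>w P. geodesics V w P \<and>
    (\<forall>u\<in>V. \<forall>v\<in>V. \<forall>q. simple_path (complete_edges V) u v q \<longrightarrow> sum b (P u v) \<le> sum b q)"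
proof -
  let ?E = "complete_edges V"
  have finE: "finite ?E" using assms(1) by (rule finite_complete_edges)
  obtain w :: "'a set \<Rightarrow> real" where w_pos: "\<forall>e\<in>?E. 0 < w e" and inj: "inj_on (sum w) (Pow ?E)"
    and near: "\<forall>A\<subseteq>?E. of_int (sum b A) \<le> sum w A \<and> sum w A < of_int (sum b A) + 1"
    using generic_perturbation[of ?E b, OF finE assms(2)] by blast
  define P where "P u v = arg_min_on (sum w) {p. simple_path ?E u v p}" for u v
  have P: "simple_path ?E u v (P u v)" "\<And>q. simple_path ?E u v q \<Longrightarrow> sum w (P u v) \<le> sum w q"
    if "u \<in> V" "v \<in> V" for u v
  proof -
    have "{p. simple_path ?E u v p} \<subseteq> Pow ?E" by (auto dest: simple_path_subset)
    then have fin: "finite {p. simple_path ?E u v p}" using finE finite_subset by blast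
    have "simple_path ?E u v (if u = v then {} else {{u, v}})"
      using simple_path_edge complete_edgesI[OF that] simple_path_refl_iff[of ?E u] by auto
    then have ne: "{p. simple_path ?E u v p} \<noteq> {}" by blast
    show "simple_path ?E u v (P u v)"
      using arg_min_if_finite(1)[OF fin ne, of "sum w"] unfolding P_def by simp
    show "sum w (P u v) \<le> sum w q" if "simple_path ?E u v q" for q
      unfolding P_def using arg_min_least[OF fin ne] that by simp
  qed
  have "geodesics V w P"
  proof
    fix u v assume uv: "u \<in> V" "v \<in> V"
    show "unique_shortest_path ?E w u v (P u v)"
      unfolding unique_shortest_path_def
    proof (intro conjI allI impI)
      show "simple_path ?E u v (P u v)" using P uv by blast
      fix q assume q: "simple_path ?E u v q \<and> q \<noteq> P u v"
      then have "sum w q \<noteq> sum w (P u v)"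
        using inj_onD[OF inj, of q "P u v"] simple_path_subset[of ?E u v q]
          simple_path_subset[OF P(1)[OF uv]] by auto
      then show "sum w (P u v) < sum w q" using P(2)[OF uv, of q] q by linarith
    qed
  qed (use assms(1) w_pos in auto)
  moreover have "sum b (P u v) \<le> sum b q" if "u \<in> V" "v \<in> V" "simple_path ?E u v q" for u v q
  proof -
    have "of_int (sum b (P u v)) \<le> sum w (P u v)" "sum w q < of_int (sum b q) + 1"
      using near simple_path_subset[OF P(1)[OF that(1,2)]] simple_path_subset[OF that(3)] by auto
    then have "of_int (sum b (P u v)) < (of_int (sum b q + 1) :: real)" using P(2)[OF that] by simp
    then show ?thesis by linarith
  qed
  ultimately show ?thesis by (intro exI[of _ w] exI[of _ P]) auto
qed

section \<open>Edge-disjoint triangles over the midpoints of a line\<close>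

definition X :: "nat \<Rightarrow> nat" where "X i = Suc i"
definition Z :: "nat \<Rightarrow> nat \<Rightarrow> nat" where "Z m j = Suc (m + j)"
definition Y :: "nat \<Rightarrow> nat \<Rightarrow> nat" where "Y m k = Suc (2 * m + k)"
definition hub :: "nat \<Rightarrow> nat" where "hub m = Suc (4 * m)"

text \<open>
  The vertices \<open>X i\<close>, \<open>Z j\<close> and \<open>Y k\<close> are laid out along a line at \<open>2 * i\<close>, \<open>2 * j\<close> and \<open>k\<close>, so that
  \<open>Y (i + j)\<close> sits at the midpoint of \<open>X i\<close> and \<open>Z j\<close>.
\<close>

definition pos :: "nat \<Rightarrow> nat \<Rightarrow> int" where
  "pos m v = (if v \<le> m then 2 * int (v - 1)
     else if v \<le> 2 * m then 2 * int (v - 1 - m) else int (v - 1 - 2 * m))"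

lemma pos_simps:
  "i < m \<Longrightarrow> pos m (X i) = 2 * int i"
  "j < m \<Longrightarrow> pos m (Z m j) = 2 * int j"
  "pos m (Y m k) = int k"
  unfolding pos_def X_def Z_def Y_def by auto

text \<open>
  For an edge this is twice the squared distance of its ends.  Among the points \<open>y\<close> of a line, the
  sum of the squared distances to two given points is smallest at their midpoint only.
\<close>

definition spread :: "nat \<Rightarrow> nat set \<Rightarrow> int" where
  "spread m e = (\<Sum>u\<in>e. \<Sum>v\<in>e. (pos m u - pos m v)\<^sup>2)"

lemma spread_doubleton: "u \<noteq> v \<Longrightarrow> spread m {u, v} = 2 * (pos m u - pos m v)\<^sup>2"
  unfolding spread_def by (simp add: power2_commute)

text \<open>
  For \<open>i, j < m\<close> the vertices \<open>X i\<close>, \<open>Y (i + j)\<close>, \<open>Z j\<close> span a triangle, and any two of its vertices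
  determine \<open>i\<close> and \<open>j\<close>.  The triangles are therefore edge-disjoint.
\<close>

definition base :: "nat \<Rightarrow> nat \<times> nat \<Rightarrow> nat set" where
  "base m = (\<lambda>(i, j). {X i, Z m j})"
definition legX :: "nat \<Rightarrow> nat \<times> nat \<Rightarrow> nat set" where
  "legX m = (\<lambda>(i, j). {X i, Y m (i + j)})"
definition legZ :: "nat \<Rightarrow> nat \<times> nat \<Rightarrow> nat set" where
  "legZ m = (\<lambda>(i, j). {Y m (i + j), Z m j})"

definition grid :: "nat \<Rightarrow> (nat \<times> nat) set" where "grid m = {..<m} \<times> {..<m}"
definition sides :: "nat \<Rightarrow> nat \<times> nat \<Rightarrow> nat set set" where
  "sides m t = {base m t, legX m t, legZ m t}"
definition legs :: "nat \<Rightarrow> nat set set" where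
  "legs m = legX m ` grid m \<union> legZ m ` grid m"
definition others :: "nat \<Rightarrow> nat set set" where
  "others m = complete_edges {1..4 * m} - (\<Union>t\<in>grid m. sides m t)"

lemmas coords = X_def Z_def Y_def hub_def
lemmas side_defs = base_def legX_def legZ_def

lemma sides_in_complete_edges: "t \<in> grid m \<Longrightarrow> sides m t \<subseteq> complete_edges {1..4 * m}"
  unfolding sides_def side_defs grid_def
  by (auto intro!: complete_edgesI simp: coords)

lemma coords_eq [simp]:
  "X i = X i' \<longleftrightarrow> i = i'" "Z m j = Z m j' \<longleftrightarrow> j = j'" "Y m k = Y m k' \<longleftrightarrow> k = k'"
  unfolding coords by auto

lemma coords_neq:
  "i < m \<Longrightarrow> X i \<noteq> Z m j" "i < m \<Longrightarrow> X i \<noteq> Y m k" "j < m \<Longrightarrow> Z m j \<noteq> Y m k"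
  "i < m \<Longrightarrow> Z m j \<noteq> X i" "i < m \<Longrightarrow> Y m k \<noteq> X i" "j < m \<Longrightarrow> Y m k \<noteq> Z m j"
  unfolding coords by auto

lemma sides_distinct: "t \<in> grid m \<Longrightarrow> distinct [base m t, legX m t, legZ m t]"
  unfolding side_defs grid_def by (auto simp: coords_neq doubleton_eq_iff)

lemma sides_disjoint: "t \<in> grid m \<Longrightarrow> t' \<in> grid m \<Longrightarrow> t \<noteq> t' \<Longrightarrow> sides m t \<inter> sides m t' = {}"
  unfolding sides_def side_defs grid_def by (auto simp: coords_neq doubleton_eq_iff)

lemma hub_notin: "e \<in> complete_edges {1..4 * m} \<Longrightarrow> hub m \<notin> e"
  unfolding complete_edges_def hub_def by auto

lemma leg_at_X: "{X i, y} \<in> legs m \<Longrightarrow> i < m \<Longrightarrow> \<exists>k. y = Y m k \<and> k < 2 * m"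
  unfolding legs_def side_defs grid_def by (auto simp: coords_neq doubleton_eq_iff)

lemma spread_leg:
  assumes "e \<in> legs m"
  shows "0 \<le> spread m e" "spread m e \<le> 8 * int m ^ 2"
proof -
  obtain i j where ij: "i < m" "j < m" "e = {X i, Y m (i + j)} \<or> e = {Y m (i + j), Z m j}"
    using assms unfolding legs_def side_defs grid_def by auto
  then obtain i k where ik: "i < m" "k < 2 * m" "e = {X i, Y m k} \<or> e = {Y m k, Z m i}"
    by (metis add_less_mono mult_2)
  then have e: "spread m e = 2 * (2 * int i - int k)\<^sup>2"
    by (auto simp: pos_simps spread_doubleton coords_neq power2_commute)
  have "\<bar>2 * int i - int k\<bar> \<le> \<bar>2 * int m\<bar>" using ik(1,2) by linarith
  then have "(2 * int i - int k)\<^sup>2 \<le> (2 * int m)\<^sup>2" unfolding abs_le_square_iff .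
  with e show "0 \<le> spread m e" "spread m e \<le> 8 * int m ^ 2" by (simp_all add: power_mult_distrib)
qed

section \<open>Configurations\<close>

text \<open>
  A configuration chooses a set of absent edges and a set of heavy edges.  Outside the triangles,
  any set of edges may be absent.  In a triangle any set of sides may be absent, which makes 8 states;
  in the ninth state only the base is absent and one leg is heavy.  This last state
  shares its absent sides with another one, and differs from it in whether the geodesic
  between the ends of the base passes over the apex.
\<close>

definition states :: "nat \<Rightarrow> nat \<times> nat \<Rightarrow> (nat set set \<times> nat set set) set" where
  "states m t = insert ({base m t}, {legX m t}) (Pow (sides m t) \<times> {{}})"

type_synonym config = "(nat \<times> nat \<Rightarrow> nat set set \<times> nat set set) \<times> nat set set"

definition configs :: "nat \<Rightarrow> config set" where
  "configs m = PiE (grid m) (states m) \<times> Pow (others m)"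

definition absent :: "nat \<Rightarrow> config \<Rightarrow> nat set set" where
  "absent m c = (\<Union>t\<in>grid m. fst (fst c t)) \<union> snd c"

definition heavy :: "nat \<Rightarrow> config \<Rightarrow> nat set set" where
  "heavy m c = (\<Union>t\<in>grid m. snd (fst c t))"

text \<open>
  In units of \<open>m\<^sup>2\<close>, an edge at the hub costs 50, an absent edge 120, a leg that is neither absent
  nor heavy between 40 and 48, and any other edge 70.  The constants are chosen so that
  the path through the hub, at cost 100, beats an absent edge, any path of three or more edges
  (at least 120), and any other path of two edges one of which costs 70 (at least 110), but loses
  to a path over two legs that are neither absent nor heavy (at most 96), and so that an edge that
  is not absent (at most 70) beats all paths of two edges (at least 80).
\<close>

definition weight :: "nat \<Rightarrow> config \<Rightarrow> nat set \<Rightarrow> int" where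
  "weight m c e = (if hub m \<in> e then 50 * int m ^ 2 else if e \<in> absent m c then 120 * int m ^ 2
     else if e \<in> legs m - heavy m c then 40 * int m ^ 2 + spread m e else 70 * int m ^ 2)"

lemma finite_grid [simp]: "finite (grid m)" unfolding grid_def by simp

lemma card_states: "t \<in> grid m \<Longrightarrow> card (states m t) = 9"
proof -
  assume t: "t \<in> grid m"
  have "card (sides m t) = 3" using sides_distinct[OF t] unfolding sides_def by simp
  moreover have "finite (sides m t)" unfolding sides_def by simp
  ultimately show ?thesis unfolding states_def
    by (simp add: card_Pow card_cartesian_product finite_cartesian_product)
qed

lemma card_configs: "2 ^ (8 * m\<^sup>2 - 2 * m - 3 * m\<^sup>2) * 9 ^ m\<^sup>2 \<le> card (configs m)"
proof -
  let ?T = "\<Union>t\<in>grid m. sides m t" and ?E = "complete_edges {1..4 * m}"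
  have "card ?E = 4 * m choose 2" using card_complete_edges[of "{1..4 * m}"] by simp
  also have "\<dots> = 8 * m\<^sup>2 - 2 * m"
    by (simp add: choose_two power2_eq_square algebra_simps)
  finally have E: "card ?E = 8 * m\<^sup>2 - 2 * m" .
  have "card ?T \<le> (\<Sum>t\<in>grid m. card (sides m t))" by (intro card_UN_le) simp
  also have "\<dots> \<le> (\<Sum>t\<in>grid m. 3)" unfolding sides_def by (intro sum_mono) (simp add: card_insert_if)
  also have "\<dots> = 3 * m\<^sup>2" unfolding grid_def by (simp add: power2_eq_square)
  finally have "8 * m\<^sup>2 - 2 * m - 3 * m\<^sup>2 \<le> card ?E - card ?T" using E by simp
  also have "\<dots> \<le> card (others m)" unfolding others_def by (rule diff_card_le_card_Diff)
      (simp add: sides_def)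
  finally have "(2::nat) ^ (8 * m\<^sup>2 - 2 * m - 3 * m\<^sup>2) \<le> 2 ^ card (others m)" by simp
  moreover have "finite (others m)" unfolding others_def by (simp add: finite_complete_edges)
  moreover have "card (PiE (grid m) (states m)) = 9 ^ m\<^sup>2"
    by (simp add: card_PiE card_states) (simp add: grid_def power2_eq_square)
  ultimately show ?thesis unfolding configs_def
    by (simp add: card_cartesian_product card_Pow)
qed

lemma states_sub: "(a, h) \<in> states m t \<Longrightarrow> a \<subseteq> sides m t \<and> h \<subseteq> sides m t"
  unfolding states_def sides_def by auto

text \<open>
  As the triangles are edge-disjoint, the local choices can be recovered from their unions.
\<close>

lemma config_local:
  assumes "c \<in> configs m" "t \<in> grid m"
  shows "absent m c \<inter> sides m t = fst (fst c t)" "heavy m c \<inter> sides m t = snd (fst c t)"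
    "absent m c \<inter> others m = snd c"
proof -
  have sub: "fst (fst c t) \<subseteq> sides m t" "snd (fst c t) \<subseteq> sides m t" if "t \<in> grid m" for t
  proof -
    have "fst c t \<in> states m t" using assms(1) that unfolding configs_def by auto
    then show "fst (fst c t) \<subseteq> sides m t" "snd (fst c t) \<subseteq> sides m t"
      using states_sub[of "fst (fst c t)" "snd (fst c t)" m t] by simp_all
  qed
  have r: "snd c \<subseteq> others m" using assms(1) unfolding configs_def by auto
  have o: "others m \<inter> sides m t = {}" if "t \<in> grid m" for t using that unfolding others_def by blast
  have eq: "t' = t" if "t' \<in> grid m" "e \<in> sides m t'" "e \<in> sides m t" for t' e
    using sides_disjoint[OF that(1) assms(2)] that(2,3) by blast
  show "heavy m c \<inter> sides m t = snd (fst c t)"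
    unfolding heavy_def using sub eq assms(2) by blast
  show "absent m c \<inter> sides m t = fst (fst c t)"
    unfolding absent_def using sub eq assms(2) r o by blast
  show "absent m c \<inter> others m = snd c"
    unfolding absent_def using sub o r by blast
qed

lemma absent_subset: "c \<in> configs m \<Longrightarrow> absent m c \<subseteq> complete_edges {1..4 * m}"
proof
  fix e assume c: "c \<in> configs m" and e: "e \<in> absent m c"
  consider t where "t \<in> grid m" "e \<in> fst (fst c t)" | "e \<in> snd c"
    using e unfolding absent_def by blast
  then show "e \<in> complete_edges {1..4 * m}"
  proof cases
    case 1
    then show ?thesis using config_local(1)[OF c 1(1)] sides_in_complete_edges by blast
  next
    case 2
    then show ?thesis using c unfolding configs_def others_def by auto
  qed
qed

section \<open>Configurations can be read off the geodesics\<close>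

locale realised_config = geodesics "{1..n}" w P for n :: nat and w P +
  fixes m :: nat and c :: config
  assumes m_pos: "0 < m" and n_large: "4 * m < n"
    and config: "c \<in> configs m"
    and shortest: "\<And>u v q. u \<in> {1..n} \<Longrightarrow> v \<in> {1..n} \<Longrightarrow> simple_path (complete_edges {1..n}) u v q \<Longrightarrow>
      sum (weight m c) (P u v) \<le> sum (weight m c) q"
begin

definition M where "M = int m ^ 2"

lemma M_pos: "0 < M" unfolding M_def using m_pos by simp

lemmas weight_eq = weight_def[of m c, folded M_def]

lemma weight_hub: "hub m \<in> e \<Longrightarrow> weight m c e = 50 * M"
  unfolding weight_eq by simp

lemma weight_absent: "e \<in> absent m c \<Longrightarrow> weight m c e = 120 * M"
  using absent_subset[OF config] hub_notin unfolding weight_eq by auto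

lemma weight_light: "e \<in> legs m \<Longrightarrow> e \<notin> heavy m c \<Longrightarrow> e \<notin> absent m c \<Longrightarrow> hub m \<notin> e \<Longrightarrow>
    weight m c e = 40 * M + spread m e"
  unfolding weight_eq by simp

lemma weight_heavy: "e \<in> heavy m c \<Longrightarrow> e \<notin> absent m c \<Longrightarrow> hub m \<notin> e \<Longrightarrow> weight m c e = 70 * M"
  unfolding weight_eq by simp

lemma spread_light: "e \<in> legs m - heavy m c \<Longrightarrow> 0 \<le> spread m e \<and> spread m e \<le> 8 * M"
  using spread_leg[of e m] unfolding M_def by simp

lemma weight_ge: "40 * M \<le> weight m c e"
  using M_pos spread_light[of e] unfolding weight_eq by auto

lemma weight_le: "e \<notin> absent m c \<Longrightarrow> weight m c e \<le> 70 * M"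
  using M_pos spread_light[of e] unfolding weight_eq by auto

lemma weight_path_ge: "40 * M * int (card p) \<le> sum (weight m c) p"
  using sum_bounded_below[of p "40 * M" "weight m c"] weight_ge by (simp add: mult.commute)

lemma weight_two: "distinct [u, x, v] \<Longrightarrow>
    sum (weight m c) {{u, x}, {x, v}} = weight m c {u, x} + weight m c {x, v}"
  by (auto simp: doubleton_eq_iff)

lemma hub_in: "hub m \<in> {1..n}" unfolding hub_def using n_large by auto

lemma weight_via_hub:
  assumes "u \<in> {1..n}" "v \<in> {1..n}" "distinct [u, hub m, v]"
  shows "sum (weight m c) (P u v) \<le> 100 * M"
proof -
  have "sum (weight m c) (P u v) \<le> sum (weight m c) {{u, hub m}, {hub m, v}}"
    using assms hub_in by (intro shortest simple_path_two complete_edgesI) auto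
  then show ?thesis using weight_two[OF assms(3)] weight_hub by simp
qed

text \<open>
  An absent edge is dearer than the path through the hub; every other edge is cheaper than any two
  edges together.
\<close>

lemma direct_iff_not_absent:
  assumes "u \<in> {1..n}" "v \<in> {1..n}" "u \<noteq> v"
  shows "P u v = {{u, v}} \<longleftrightarrow> {u, v} \<notin> absent m c"
proof
  assume direct: "P u v = {{u, v}}"
  show "{u, v} \<notin> absent m c"
  proof
    assume a: "{u, v} \<in> absent m c"
    then have "distinct [u, hub m, v]"
      using absent_subset[OF config] hub_notin assms(3) by fastforce
    then show False using weight_via_hub[OF assms(1,2)] weight_absent[OF a] direct M_pos by simp
  qed
next
  assume "{u, v} \<notin> absent m c"
  moreover have "sum (weight m c) (P u v) \<le> sum (weight m c) {{u, v}}"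
    using assms by (intro shortest simple_path_edge complete_edgesI)
  ultimately have le: "sum (weight m c) (P u v) \<le> 70 * M" using weight_le[of "{u, v}"] by simp
  show "P u v = {{u, v}}"
    using P_path[OF assms(1,2)] assms(3)
  proof (cases rule: simple_path_cases)
    case (two y)
    then show ?thesis
      using le weight_two[of u y v] weight_ge[of "{u, y}"] weight_ge[of "{y, v}"] assms(3) M_pos by simp
  next
    case long
    then have "40 * M * 3 \<le> 40 * M * int (card (P u v))" using M_pos by (intro mult_left_mono) auto
    then show ?thesis using le weight_path_ge[of "P u v"] M_pos by linarith
  qed
qed

text \<open>
  If no leg is heavy, only another path over two such legs could compete with the path over the apex.
  Its middle vertex is some \<open>Y k\<close>, and then the midpoint property gives \<open>k = i + j\<close>.  A heavy leg
  makes the path over the apex dearer than the path through the hub.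
\<close>

lemma light_iff_path_via_midpoint:
  assumes t: "t \<in> grid m" "t = (i, j)" and a: "fst (fst c t) = {base m t}"
  shows "P (X i) (Z m j) = {legX m t, legZ m t} \<longleftrightarrow> snd (fst c t) = {}"
proof -
  let ?y = "Y m (i + j)" and ?b = "weight m c"
  have ij: "i < m" "j < m" using t unfolding grid_def by auto
  have V: "X i \<in> {1..n}" "Z m j \<in> {1..n}" "?y \<in> {1..n}" "distinct [X i, ?y, Z m j]"
    "distinct [X i, hub m, Z m j]"
    using ij n_large by (auto simp: coords)
  have legs: "legX m t = {X i, ?y}" "legZ m t = {?y, Z m j}" unfolding t(2) side_defs by simp_all
  have legs_in: "legX m t \<in> legs m" "legZ m t \<in> legs m" unfolding legs_def using t(1) by blast+
  have nohub: "hub m \<notin> legX m t" "hub m \<notin> legZ m t"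
    using sides_in_complete_edges[OF t(1)] hub_notin unfolding sides_def by blast+
  have ab: "absent m c \<inter> sides m t = {base m t}" using config_local(1)[OF config t(1)] a by simp
  have present: "legX m t \<notin> absent m c" "legZ m t \<notin> absent m c"
  proof -
    have "legX m t \<in> sides m t" "legZ m t \<in> sides m t" unfolding sides_def by simp_all
    moreover have "legX m t \<noteq> base m t" "legZ m t \<noteq> base m t"
      using sides_distinct[OF t(1)] unfolding distinct.simps list.set by blast+
    ultimately show "legX m t \<notin> absent m c" "legZ m t \<notin> absent m c"
      using ab by blast+
  qed
  have state: "snd (fst c t) \<in> {{}, {legX m t}}"
  proof -
    have "fst c t \<in> states m t" using config t(1) unfolding configs_def by auto
    then show ?thesis unfolding states_def by (elim insertE SigmaE) simp_all
  qed
  have base_absent: "{X i, Z m j} \<in> absent m c"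
  proof -
    have "base m t \<in> absent m c" using ab by blast
    then show ?thesis unfolding t(2) base_def by simp
  qed
  have via: "sum ?b {legX m t, legZ m t} = ?b (legX m t) + ?b (legZ m t)"
    unfolding legs by (rule weight_two[OF V(4)])
  show ?thesis
  proof
    assume P: "P (X i) (Z m j) = {legX m t, legZ m t}"
    show "snd (fst c t) = {}"
    proof (rule ccontr)
      assume "snd (fst c t) \<noteq> {}"
      then have "legX m t \<in> heavy m c" using state t(1) unfolding heavy_def by blast
      then have "?b (legX m t) = 70 * M" using weight_heavy present nohub by blast
      then have "110 * M \<le> sum ?b (P (X i) (Z m j))" using P via weight_ge[of "legZ m t"] by simp
      then show False using weight_via_hub[OF V(1,2,5)] M_pos by linarith
    qed
  next
    assume "snd (fst c t) = {}"
    then have "legX m t \<notin> heavy m c" "legZ m t \<notin> heavy m c"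
      using config_local(2)[OF config t(1)] unfolding sides_def by auto
    then have light: "?b (legX m t) = 40 * M + spread m (legX m t)"
      "?b (legZ m t) = 40 * M + spread m (legZ m t)"
      using weight_light legs_in present nohub by blast+
    have path: "simple_path E (X i) (Z m j) {legX m t, legZ m t}"
      unfolding legs using V by (intro simple_path_two complete_edgesI) auto
    have le: "sum ?b (P (X i) (Z m j)) \<le> 80 * M + spread m (legX m t) + spread m (legZ m t)"
      using shortest[OF V(1,2) path] via light by simp
    then have le96: "sum ?b (P (X i) (Z m j)) \<le> 96 * M"
      using spread_leg(2)[OF legs_in(1)] spread_leg(2)[OF legs_in(2)] unfolding M_def by linarith
    have "X i \<noteq> Z m j" using V(4) by simp
    with P_path[OF V(1,2)] show "P (X i) (Z m j) = {legX m t, legZ m t}"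
    proof (cases rule: simple_path_cases)
      case edge
      then show ?thesis using le96 weight_absent[OF base_absent] M_pos by simp
    next
      case long
      then have "40 * M * 3 \<le> 40 * M * int (card (P (X i) (Z m j)))"
        using M_pos by (intro mult_left_mono) auto
      then show ?thesis using le96 weight_path_ge[of "P (X i) (Z m j)"] M_pos by linarith
    next
      case (two y)
      have sum: "sum ?b (P (X i) (Z m j)) = ?b {X i, y} + ?b {y, Z m j}"
        unfolding two(4) using two V(4) by (intro weight_two) auto
      have light_or: "e \<in> legs m \<and> ?b e = 40 * M + spread m e \<or> 70 * M \<le> ?b e" if "hub m \<notin> e" for e
        using that M_pos unfolding weight_eq by auto
      show ?thesis
      proof (cases "y = hub m")
        case True
        then show ?thesis using sum le96 weight_hub M_pos by simp
      next
        case False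
        then have h: "hub m \<notin> {X i, y}" "hub m \<notin> {y, Z m j}" using V(5) by auto
        have l1: "{X i, y} \<in> legs m" "?b {X i, y} = 40 * M + spread m {X i, y}"
          using light_or[OF h(1)] weight_ge[of "{y, Z m j}"] sum le96 M_pos by linarith+
        have l2: "?b {y, Z m j} = 40 * M + spread m {y, Z m j}"
          using light_or[OF h(2)] weight_ge[of "{X i, y}"] sum le96 M_pos by linarith
        obtain k where k: "y = Y m k" using leg_at_X[OF l1(1) ij(1)] by blast
        have "spread m {X i, y} + spread m {y, Z m j} \<le> spread m (legX m t) + spread m (legZ m t)"
          using le sum l1(2) l2 by linarith
        then have "(2 * int i - int k)\<^sup>2 + (int k - 2 * int j)\<^sup>2
            \<le> (2 * int i - int (i + j))\<^sup>2 + (int (i + j) - 2 * int j)\<^sup>2"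
          unfolding legs using two V(4) ij by (simp add: spread_doubleton k pos_simps)
        then have "2 * (int k - int (i + j))\<^sup>2 \<le> 0" by (simp add: power2_eq_square algebra_simps)
        then have "k = i + j" by simp
        then show ?thesis unfolding two(4) legs k by simp
      qed
    qed
  qed
qed

end

lemma weight_pos:
  assumes "0 < m"
  shows "0 < weight m c e"
  using assms spread_leg(1)[of e m] unfolding weight_def by (auto intro: add_pos_nonneg)

lemma realised_config_exists:
  assumes "0 < m" "4 * m < n" "c \<in> configs m"
  shows "\<exists>P. \<exists>w. realised_config n w P m c"
proof -
  obtain w P where P: "geodesics {1..n} w P"
    "\<forall>u\<in>{1..n}. \<forall>v\<in>{1..n}. \<forall>q. simple_path (complete_edges {1..n}) u v q \<longrightarrow>
      sum (weight m c) (P u v) \<le> sum (weight m c) q"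
    using integer_weight_geodesics[of "{1..n}" "weight m c"] weight_pos[OF assms(1)] by auto
  have "realised_config n w P m c"
    unfolding realised_config_def realised_config_axioms_def using P assms by blast
  then show ?thesis by blast
qed

lemma config_read_off:
  assumes "realised_config n w P m c" "realised_config n w' P' m c'"
    and eq: "\<And>u v. u \<in> {1..n} \<Longrightarrow> v \<in> {1..n} \<Longrightarrow> u \<noteq> v \<Longrightarrow> P u v = P' u v"
  shows "c = c'"
proof -
  interpret A: realised_config n w P m c by fact
  interpret B: realised_config n w' P' m c' by fact
  have "e \<in> absent m c \<longleftrightarrow> e \<in> absent m c'" for e
  proof (cases "e \<in> complete_edges {1..4 * m}")
    case True
    then obtain u v where e: "e = {u, v}" "u \<in> {1..4 * m}" "v \<in> {1..4 * m}" "u \<noteq> v"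
      unfolding complete_edges_def by blast
    then have V: "u \<in> {1..n}" "v \<in> {1..n}" using A.n_large by auto
    show ?thesis
      using A.direct_iff_not_absent[OF V e(4)] B.direct_iff_not_absent[OF V e(4)] eq[OF V e(4)]
      unfolding e(1) by simp
  next
    case False
    then show ?thesis using absent_subset[OF A.config] absent_subset[OF B.config] by blast
  qed
  then have absent: "absent m c = absent m c'" by blast
  have base_mem: "\<exists>t. t \<in> grid m" using A.m_pos unfolding grid_def by auto
  have others: "snd c = snd c'"
    using base_mem config_local(3)[OF A.config] config_local(3)[OF B.config] absent by auto
  have "fst c t = fst c' t" if t: "t \<in> grid m" for t
  proof -
    have first: "fst (fst c t) = fst (fst c' t)"
      using config_local(1)[OF A.config t] config_local(1)[OF B.config t] absent by simp
    have st: "fst c t \<in> states m t" "fst c' t \<in> states m t"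
      using A.config B.config t unfolding configs_def by auto
    have "snd (fst c t) = snd (fst c' t)"
    proof (cases "fst (fst c t) = {base m t}")
      case False
      then have "snd s = {}" if "s \<in> states m t" "fst s = fst (fst c t)" for s
        using that unfolding states_def by (elim insertE SigmaE) simp_all
      then show ?thesis using st first by simp
    next
      case True
      obtain i j where ij: "t = (i, j)" by (cases t)
      then have ij': "i < m" "j < m" using t unfolding grid_def by auto
      have V: "X i \<in> {1..n}" "Z m j \<in> {1..n}" "X i \<noteq> Z m j"
        using ij' A.n_large by (auto simp: coords)
      have "snd (fst c t) = {} \<longleftrightarrow> snd (fst c' t) = {}"
        using A.light_iff_path_via_midpoint[OF t ij True]
          B.light_iff_path_via_midpoint[OF t ij True[unfolded first]] eq[OF V] by simp
      moreover have "snd s = {} \<or> snd s = {legX m t}" if "s \<in> states m t" for s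
        using that unfolding states_def by (elim insertE SigmaE) simp_all
      ultimately show ?thesis using st by metis
    qed
    with first show ?thesis by (simp add: prod_eq_iff)
  qed
  moreover have "fst c \<in> PiE (grid m) (states m)" "fst c' \<in> PiE (grid m) (states m)"
    using A.config B.config unfolding configs_def by auto
  ultimately have "fst c = fst c'" by (intro PiE_ext)
  with others show ?thesis by (simp add: prod_eq_iff)
qed

lemma card_configs_le:
  assumes "0 < m" "4 * m < n"
  shows "card (configs m) \<le> card (strictly_metric_systems n)"
proof -
  let ?V = "{1..n}"
  obtain P where P: "\<forall>c\<in>configs m. \<exists>w. realised_config n w (P c) m c"
    using bchoice[of "configs m" "\<lambda>c P. \<exists>w. realised_config n w P m c"]
      realised_config_exists[OF assms] by blast
  have geo: "\<exists>w. geodesics ?V w (P c)" if "c \<in> configs m" for c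
    using P that unfolding realised_config_def by blast
  define S where "S c = geodesics.system ?V (P c)" for c
  have "S ` configs m \<subseteq> strictly_metric_systems n"
  proof
    fix s assume "s \<in> S ` configs m"
    then obtain c w where c: "s = S c" "geodesics ?V w (P c)" using geo by blast
    show "s \<in> strictly_metric_systems n"
      unfolding strictly_metric_systems_def c(1) S_def
      using geodesics.system_consistent[OF c(2)] geodesics.system_strictly_metric[OF c(2)] by simp
  qed
  moreover have "inj_on S (configs m)"
  proof (rule inj_onI)
    fix c c' assume c: "c \<in> configs m" "c' \<in> configs m" and eq: "S c = S c'"
    obtain w w' where real: "realised_config n w (P c) m c" "realised_config n w' (P c') m c'"
      using P c by blast
    then have geo: "geodesics ?V w (P c)" "geodesics ?V w' (P c')"
      unfolding realised_config_def by blast+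
    have "P c u v = P c' u v" if uv: "u \<in> ?V" "v \<in> ?V" "u \<noteq> v" for u v
    proof -
      have "P c u v \<in> S c" unfolding S_def geodesics.system_def[OF geo(1)] using uv by blast
      then have "P c u v \<in> geodesics.system ?V (P c')" using eq unfolding S_def by simp
      then show ?thesis
        using geodesics.systemE(4)[OF geo(2)] geodesics.P_path[OF geo(1) uv(1,2)] by blast
    qed
    then show "c = c'" using config_read_off[OF real] by blast
  qed
  ultimately show ?thesis
    using card_inj_on_le finite_strictly_metric_systems by blast
qed

section \<open>Asymptotics\<close>

text \<open>
  Raised to the power 25 this is \<open>2 ^ 79 \<le> 9 ^ 25\<close>.
\<close>

lemma powr_nine: "2 powr 3.16 \<le> (9 :: real)"
proof (rule power_le_imp_le_base)
  have "(2 powr 3.16 :: real) ^ Suc 24 = 2 powr (3.16 * real (Suc 24))" by (simp only: powr_power mult.commute)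
  also have "3.16 * real (Suc 24) = 79" by simp
  also have "2 powr (79 :: real) = 2 ^ 79" by (rule powr_numeral) simp
  also have "(2 :: real) ^ 79 \<le> 9 ^ Suc 24" by simp
  finally show "(2 powr 3.16 :: real) ^ Suc 24 \<le> 9 ^ Suc 24" .
qed simp

text \<open>
  Raised to the power 25 this is \<open>(27 / 4) ^ 25 \<le> 2 ^ 69\<close>.
\<close>

lemma powr_27_4: "27 / 4 \<le> (2 powr 2.76 :: real)"
proof (rule power_le_imp_le_base)
  have "(27 / 4 :: real) ^ Suc 24 \<le> 2 ^ 69" by (simp add: power_divide)
  also have "(2 :: real) ^ 69 = 2 powr 69" by (rule powr_numeral[symmetric]) simp
  also have "(69 :: real) = 2.76 * real (Suc 24)" by simp
  also have "2 powr (2.76 * real (Suc 24)) = (2 powr 2.76 :: real) ^ Suc 24"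
    by (simp only: powr_power mult.commute)
  finally show "(27 / 4 :: real) ^ Suc 24 \<le> (2 powr 2.76) ^ Suc 24" .
qed simp

lemma upper_bound: "real (card (strictly_metric_systems n)) \<le> 2 powr (1.38 * (real n)\<^sup>2)"
proof -
  let ?N = "card (complete_edges {1..n})"
  have "?N = n * (n - 1) div 2" using card_complete_edges[of "{1..n}"] by (simp add: choose_two)
  then have "2 * ?N \<le> n * (n - 1)" by simp
  also have "\<dots> \<le> n\<^sup>2" by (simp add: power2_eq_square)
  finally have "2 * real ?N \<le> (real n)\<^sup>2" by (metis of_nat_le_iff of_nat_mult of_nat_numeral of_nat_power)
  then have N: "2.76 * real ?N \<le> 1.38 * (real n)\<^sup>2" by simp
  have "real (card (strictly_metric_systems n)) \<le> (27 / 4) ^ ?N" by (rule card_strictly_metric_le)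
  also have "\<dots> \<le> (2 powr 2.76) ^ ?N" using powr_27_4 by (intro power_mono) auto
  also have "\<dots> = 2 powr (2.76 * real ?N)" by (simp add: powr_power mult.commute)
  also have "\<dots> \<le> 2 powr (1.38 * (real n)\<^sup>2)" using N by (intro powr_mono) auto
  finally show ?thesis .
qed

text \<open>
  With \<open>n\<close> close to \<open>4 * m\<close> there are about \<open>5 * m\<^sup>2\<close> free edges outside the triangles, and each of the
  \<open>m\<^sup>2\<close> triangles contributes more than \<open>3.16\<close> bits.  The sum \<open>8.16 * m\<^sup>2\<close> is \<open>0.51 * (4 * m)\<^sup>2\<close>, and
  \<open>20 / n\<close> is a generous allowance for the terms that are linear in \<open>n\<close>.
\<close>

lemma lower_bound:
  assumes "5 \<le> n"
  shows "2 powr (0.51 * (real n)\<^sup>2 * (1 - 20 / real n)) \<le> real (card (strictly_metric_systems n))"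
proof -
  \<comment> \<open>One vertex is set aside for the hub.\<close>
  define m where "m = (n - 1) div 4"
  have m: "0 < m" "4 * m < n" "n \<le> 4 * m + 4" unfolding m_def using assms by linarith+
  let ?k = "8 * m\<^sup>2 - 2 * m - 3 * m\<^sup>2"
  have "5 * m\<^sup>2 \<le> ?k + 2 * m" by simp
  then have "real (5 * m\<^sup>2) \<le> real (?k + 2 * m)" by (rule of_nat_mono)
  then have k: "5 * (real m)\<^sup>2 - 2 * real m \<le> real ?k" by simp
  have "(real n - 4)\<^sup>2 \<le> (4 * real m)\<^sup>2" using m(3) assms by (intro power_mono) auto
  then have "(real n)\<^sup>2 - 8 * real n + 16 \<le> 16 * (real m)\<^sup>2" by (simp add: power2_eq_square algebra_simps)
  moreover have "4 * real m \<le> real n" using m(2) by simp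
  ultimately have "0.51 * (real n)\<^sup>2 - 0.51 * 20 * real n \<le> 8.16 * (real m)\<^sup>2 - 2 * real m"
    by (simp add: field_simps)
  moreover have "0.51 * (real n)\<^sup>2 * (1 - 20 / real n) = 0.51 * (real n)\<^sup>2 - 0.51 * 20 * real n"
    using assms by (simp add: field_simps power2_eq_square)
  ultimately have "2 powr (0.51 * (real n)\<^sup>2 * (1 - 20 / real n))
      \<le> 2 powr (real ?k + 3.16 * real (m\<^sup>2))"
    using k by (intro powr_mono) auto
  also have "\<dots> = 2 ^ ?k * (2 powr 3.16) ^ m\<^sup>2" by (simp add: powr_add powr_realpow powr_power mult.commute)
  also have "\<dots> \<le> 2 ^ ?k * 9 ^ m\<^sup>2" using powr_nine by (intro mult_left_mono power_mono) auto
  also have "\<dots> = real (2 ^ ?k * 9 ^ m\<^sup>2)" by simp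
  also have "\<dots> \<le> real (card (strictly_metric_systems n))"
    using card_configs[of m] card_configs_le[OF m(1,2)] by (intro of_nat_mono) linarith
  finally show ?thesis .
qed

theorem theorem5p1:
  "\<exists>\<epsilon> \<delta> :: nat \<Rightarrow> real. \<epsilon> \<in> o(\<lambda>_. 1) \<and> \<delta> \<in> o(\<lambda>_. 1) \<and>
     (\<forall>\<^sub>F n in sequentially.
        2 powr (0.51 * (real n)\<^sup>2 * (1 - \<epsilon> n)) \<le> real (card (strictly_metric_systems n)) \<and>
        real (card (strictly_metric_systems n)) \<le> 2 powr (1.38 * (real n)\<^sup>2 * (1 - \<delta> n)))"
proof (intro exI conjI)
  show "(\<lambda>n. 20 / real n) \<in> o(\<lambda>_. 1)"
    by (rule smalloI_tendsto) (simp_all add: lim_const_over_n)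
  show "(\<lambda>_. 0) \<in> o(\<lambda>_. 1 :: real)" by simp
  show "\<forall>\<^sub>F n in sequentially.
      2 powr (0.51 * (real n)\<^sup>2 * (1 - 20 / real n)) \<le> real (card (strictly_metric_systems n)) \<and>
      real (card (strictly_metric_systems n)) \<le> 2 powr (1.38 * (real n)\<^sup>2 * (1 - 0))"
    using eventually_ge_at_top[of 5] by eventually_elim (use lower_bound upper_bound in auto)
qed

end
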